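(* Suppose the assumptions on the data in the context hold. Let $u^*\in U(\delta)$ satisfy $J(u^* )=\min_{u\in U(\delta)}J(u)$. Assume that $u^*$ and $J'(u^* )$ are Lipschitz continuous functions on $[0,T]$, and that there are constants $C_1,C_2>0$ such that for all $u,v\in L^2([0,T];\mathbb R)$ $$\|J'(u)-J'(v)\|\le C_1\|u-v\|,\qquad \big(J'(u)-J'(v),u-v\big)\ge C_2\|u-v\|^2 .$$ Let $\rho>0$ be such that $0<1-2C_2\rho+(1+2C_1^2)\rho^2<1$. For each positive integer $N$ let $u^{0,N}\in U_N$ and let $$u^{i+1,N}=\mathbb P_N\big(u^{i,N}-\rho J_N'(u^{i,N})\big),\quad i=0,1,2,\dots,\qquad \varepsilon_N:=\sup_i\|J'(u^{i,N})-J_N'(u^{i,N})\| .$$ Then there is a constant $C>0$ independent of $N$ such that $$\limsup_{i\to\infty}\|u^*-u^{i+1,N}\|\le C(\Delta t+\varepsilon_N),\qquad \Delta t=T/N .$$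
   Context: **Control problem.** Everything is one-dimensional. $T\in(0,\infty)$; $(\Omega,\mathcal F,\{\mathcal F_t\},P)$ is a complete probability space with the natural filtration of a one-dimensional Brownian motion $W$. Controls are deterministic $u\in L^2([0,T];\mathbb R)$, with inner product $(u,v)=\int_0^Tuv\,dt$ and norm $\|\cdot\|$. For each $u$ the state $y^u$ is the unique adapted solution with $\int_0^T\mathbb E|y_t^u|^2dt<\infty$ of $dy_t^u=b(t,y_t^u,u(t))dt+\sigma(y_t^u,u(t))dW_t$, $y_0^u=y^0\in\mathbb R$ (well-posedness is a standing assumption), with linear drift $b(t,y,u)=b_y'(t)\,y+b_u'(t)\,u+m(t)$, where $b_y',b_u',m$ are deterministic functions of $t$ (the symbols $b_y',b_u'$ are names of coefficient functions). $J(u)=\mathbb E\big[\int_0^T(h(y_t^u)+j(u(t)))dt+k(y_T^u)\big]$ is continuously Fréchet differentiable on $L^2([0,T];\mathbb R)$ with gradient $J'(u)\in L^2([0,T];\mathbb R)$. For $\delta\in\mathbb R$, $U(\delta)=\{u\in L^2([0,T];\mathbb R):\int_0^T\mathbb E[y_t^u]dt\le\delta\}$. **Assumptions on the data.** There are positive constants $C_b,C_\sigma,c_b,C_t$ such that $|b_y'(t)|+|b_u'(t)|\le C_b$, $|b_u'(t)|\ge c_b$; $b_y',b_u'$ are differentiable in $t$ with $|b_{y,t}''|+|b_{u,t}''|\le C_t$ (bounds on the $t$-derivatives); $\sigma(y,u)$ is continuously differentiable with $|\sigma_y'|+|\sigma_u'|\le C_\sigma$; $h,j,k:\mathbb R\to\mathbb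 R$ are continuously differentiable with derivatives of at most linear growth. **Discretization of controls.** For a positive integer $N$: $\Delta t=T/N$, $t_n=n\Delta t$, $I_n^N=[t_n,t_{n+1})$ for $n\le N-2$, $I_{N-1}^N=[t_{N-1},t_N]$, $\chi_A$ the indicator function; $U_N\subset L^2([0,T];\mathbb R)$ is the space of functions (a.e.) constant on each $I_n^N$; $U^N(\delta)=U_N\cap U(\delta)$; $\mathbb P_N$ is the projection of $L^2([0,T];\mathbb R)$ onto the convex set $U^N(\delta)$, i.e. $\mathbb P_Nw\in U^N(\delta)$ and $(\mathbb P_Nw-w,v-\mathbb P_Nw)\ge0$ for all $v\in U^N(\delta)$. **Discrete gradient $J_N'$ (least squares Monte Carlo).** Let $g=k'$ and $\hat f(t,y,p,q,u)=h'(y)+p\,b_y'(t)+q\,\sigma_y'(y,u)$. Fix $L$ independent copies $\Delta_\lambda W_{n+1}$, $\lambda=1,\dots,L$, of the Brownian increments $W_{t_{n+1}}-W_{t_n}$, $n=0,\dots,N-1$, and, for each $n=0,\dots,N-1$, row vectors of basis functions on $\mathbb R$: $\boldsymbol\eta^n=(\eta_1^n,\dots,\eta_K^n)$ and $\boldsymbol\xi^n=(\xi_1^n,\dots,\xi_{\tilde K}^n)$. For $u\in U_N$ define Euler paths ${}_\lambda y_0=y^0$, ${}_\lambda y_{n+1}={}_\lambda y_n+b(t_n,{}_\lambda y_n,u(t_n))\Delta t+\sigma({}_\lambda y_n,u(t_n))\Delta_\lambda W_{n+1}$. Set $\hat P_N^{K,L}=g$ and, backward for $n=N-1,\dots,0$,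 $\hat Q_n^{\tilde K,L}=\boldsymbol\xi^n\boldsymbol\alpha_{1,n}$, $\hat P_n^{K,L}=\boldsymbol\eta^n\boldsymbol\alpha_{0,n}$, where $\boldsymbol\alpha_{1,n}\in\mathbb R^{\tilde K}$ minimizes $\frac1L\sum_{\lambda=1}^L\big(\frac{\Delta_\lambda W_{n+1}}{\Delta t}\hat P_{n+1}^{K,L}({}_\lambda y_{n+1})-\boldsymbol\xi^n({}_\lambda y_n)\boldsymbol\alpha\big)^2$ over $\boldsymbol\alpha\in\mathbb R^{\tilde K}$, and $\boldsymbol\alpha_{0,n}\in\mathbb R^K$ minimizes $\frac1L\sum_{\lambda=1}^L\big(\hat P_{n+1}^{K,L}({}_\lambda y_{n+1})+\hat f(t_n,{}_\lambda y_n,\hat P_{n+1}^{K,L}({}_\lambda y_{n+1}),\hat Q_n^{\tilde K,L}({}_\lambda y_n),u(t_n))\Delta t-\boldsymbol\eta^n({}_\lambda y_n)\boldsymbol\alpha\big)^2$ over $\boldsymbol\alpha\in\mathbb R^K$. Then $J_N'(u)\in U_N$ is the function which on $I_n^N$ equals $$\frac1L\sum_{\lambda=1}^L\Big[\hat P_n^{K,L}({}_\lambda y_n)\,b_u'(t_n)+\hat Q_n^{\tilde K,L}({}_\lambda y_n)\,\sigma_u'({}_\lambda y_n,u(t_n))\Big]+j'(u(t_n)).$$ The samples are fixed (one realization) throughout the iteration. *)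

theory Defs
  imports "HOL-Probability.Probability"
begin

section \<open>The space of controls\<close>

text \<open>Elements of \<open>L\<^sup>2([0,T])\<close> are represented by Borel functions; two functions that agree
  almost everywhere on \<open>[0,T]\<close> represent the same control, and values outside \<open>[0,T]\<close> are
  irrelevant. All notions below respect this identification.\<close>

abbreviation time_measure :: "real \<Rightarrow> real measure" where
  "time_measure T \<equiv> restrict_space lborel {0..T}"

definition L2 :: "real \<Rightarrow> (real \<Rightarrow> real) set" where
  "L2 T = {u \<in> borel_measurable (time_measure T). integrable (time_measure T) (\<lambda>t. (u t)\<^sup>2)}"

definition L2_inner :: "real \<Rightarrow> (real \<Rightarrow> real) \<Rightarrow> (real \<Rightarrow> real) \<Rightarrow> real" where
  "L2_inner T u v = (\<integral>t. u t * v t \<partial>time_measure T)"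

definition L2_norm :: "real \<Rightarrow> (real \<Rightarrow> real) \<Rightarrow> real" where
  "L2_norm T u = sqrt (L2_inner T u u)"

definition has_L2_gradient ::
    "real \<Rightarrow> ((real \<Rightarrow> real) \<Rightarrow> real) \<Rightarrow> ((real \<Rightarrow> real) \<Rightarrow> real \<Rightarrow> real) \<Rightarrow> bool" where
  "has_L2_gradient T J dJ \<longleftrightarrow>
     (\<forall>u\<in>L2 T. dJ u \<in> L2 T \<and>
        (\<forall>e>0. \<exists>d>0. \<forall>v\<in>L2 T. L2_norm T v < d \<longrightarrow>
           \<bar>J (\<lambda>t. u t + v t) - J u - L2_inner T (dJ u) v\<bar> \<le> e * L2_norm T v))"

definition continuously_L2_differentiable ::
    "real \<Rightarrow> ((real \<Rightarrow> real) \<Rightarrow> real) \<Rightarrow> ((real \<Rightarrow> real) \<Rightarrow> real \<Rightarrow> real) \<Rightarrow> bool" where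
  "continuously_L2_differentiable T J dJ \<longleftrightarrow>
     has_L2_gradient T J dJ \<and>
     (\<forall>u\<in>L2 T. \<forall>e>0. \<exists>d>0. \<forall>v\<in>L2 T. L2_norm T (\<lambda>t. v t - u t) < d \<longrightarrow>
        L2_norm T (\<lambda>t. dJ v t - dJ u t) < e)"

definition L2_lipschitz :: "real \<Rightarrow> (real \<Rightarrow> real) \<Rightarrow> bool" where
  "L2_lipschitz T f \<longleftrightarrow>
     (\<exists>g C. C-lipschitz_on {0..T} g \<and> (AE t in time_measure T. f t = g t))"

text \<open>The variational characterization of the projection onto a convex set \<open>A\<close>.\<close>

definition is_L2_projection ::
    "real \<Rightarrow> (real \<Rightarrow> real) set \<Rightarrow> (real \<Rightarrow> real) \<Rightarrow> (real \<Rightarrow> real) \<Rightarrow> bool" where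
  "is_L2_projection T A w p \<longleftrightarrow>
     p \<in> A \<and> (\<forall>v\<in>A. 0 \<le> L2_inner T (\<lambda>t. p t - w t) (\<lambda>t. v t - p t))"


section \<open>Brownian motion and the Ito integral\<close>

text \<open>The natural filtration, augmented by the null sets of the complete space \<open>M\<close>.\<close>

definition natural_filtration :: "'a measure \<Rightarrow> (real \<Rightarrow> 'a \<Rightarrow> real) \<Rightarrow> real \<Rightarrow> 'a measure" where
  "natural_filtration M W t =
     sigma (space M)
       ({W s -` B \<inter> space M | s B. 0 \<le> s \<and> s \<le> t \<and> B \<in> sets borel} \<union> null_sets M)"

definition brownian_motion ::
    "'a measure \<Rightarrow> (real \<Rightarrow> 'a measure) \<Rightarrow> real \<Rightarrow> (real \<Rightarrow> 'a \<Rightarrow> real) \<Rightarrow> bool" where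
  "brownian_motion M F T W \<longleftrightarrow>
     (\<forall>t\<in>{0..T}. W t \<in> borel_measurable M \<and> W t \<in> borel_measurable (F t)) \<and>
     (AE \<omega> in M. W 0 \<omega> = 0) \<and>
     (AE \<omega> in M. continuous_on {0..T} (\<lambda>t. W t \<omega>)) \<and>
     (\<forall>s t. 0 \<le> s \<and> s < t \<and> t \<le> T \<longrightarrow>
        distributed M lborel (\<lambda>\<omega>. W t \<omega> - W s \<omega>) (normal_density 0 (sqrt (t - s))) \<and>
        prob_space.indep_set M (sets (F s))
          (sets (vimage_algebra (space M) (\<lambda>\<omega>. W t \<omega> - W s \<omega>) borel)))"

definition progressive ::
    "(real \<Rightarrow> 'a measure) \<Rightarrow> real \<Rightarrow> (real \<Rightarrow> 'a \<Rightarrow> real) \<Rightarrow> bool" where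
  "progressive F T X \<longleftrightarrow>
     (\<forall>t\<in>{0..T}. (\<lambda>(s, \<omega>). X s \<omega>) \<in> borel_measurable (time_measure t \<Otimes>\<^sub>M F t))"

text \<open>A simple process on \<open>[0,t]\<close> is given by a partition \<open>\<tau> 0 \<le> \<dots> \<le> \<tau> n\<close> and bounded
  \<open>F (\<tau> i)\<close>-measurable weights \<open>\<phi> i\<close>.\<close>

definition simple_process ::
    "(real \<Rightarrow> 'a measure) \<Rightarrow> real \<Rightarrow> nat \<Rightarrow> (nat \<Rightarrow> real) \<Rightarrow> (nat \<Rightarrow> 'a \<Rightarrow> real) \<Rightarrow> bool" where
  "simple_process F t n \<tau> \<phi> \<longleftrightarrow>
     0 \<le> \<tau> 0 \<and> mono_on {..n} \<tau> \<and> \<tau> n \<le> t \<and>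
     (\<forall>i<n. \<phi> i \<in> borel_measurable (F (\<tau> i)) \<and>
            (\<exists>B. \<forall>\<omega>\<in>space (F (\<tau> i)). \<bar>\<phi> i \<omega>\<bar> \<le> B))"

definition simple_value ::
    "nat \<Rightarrow> (nat \<Rightarrow> real) \<Rightarrow> (nat \<Rightarrow> 'a \<Rightarrow> real) \<Rightarrow> real \<Rightarrow> 'a \<Rightarrow> real" where
  "simple_value n \<tau> \<phi> s \<omega> = (\<Sum>i<n. \<phi> i \<omega> * indicator {\<tau> i<..\<tau> (Suc i)} s)"

definition simple_ito ::
    "(real \<Rightarrow> 'a \<Rightarrow> real) \<Rightarrow> nat \<Rightarrow> (nat \<Rightarrow> real) \<Rightarrow> (nat \<Rightarrow> 'a \<Rightarrow> real) \<Rightarrow> 'a \<Rightarrow> real" where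
  "simple_ito W n \<tau> \<phi> \<omega> = (\<Sum>i<n. \<phi> i \<omega> * (W (\<tau> (Suc i)) \<omega> - W (\<tau> i) \<omega>))"

text \<open>\<open>I\<close> is (a version of) the stochastic integral of \<open>X\<close> over \<open>[0,t]\<close>: the \<open>L\<^sup>2(P)\<close>-limit of
  the integrals of simple processes that approximate \<open>X\<close> in \<open>L\<^sup>2(dt \<otimes> P)\<close>.\<close>

definition has_ito_integral ::
    "'a measure \<Rightarrow> (real \<Rightarrow> 'a measure) \<Rightarrow> (real \<Rightarrow> 'a \<Rightarrow> real) \<Rightarrow> real \<Rightarrow>
     (real \<Rightarrow> 'a \<Rightarrow> real) \<Rightarrow> ('a \<Rightarrow> real) \<Rightarrow> bool" where
  "has_ito_integral M F W t X I \<longleftrightarrow>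
     progressive F t X \<and> I \<in> borel_measurable M \<and>
     (\<exists>n \<tau> \<phi>. (\<forall>k::nat. simple_process F t (n k) (\<tau> k) (\<phi> k)) \<and>
        (\<lambda>k. \<integral>\<^sup>+\<omega>. (\<integral>\<^sup>+s. ennreal ((X s \<omega> - simple_value (n k) (\<tau> k) (\<phi> k) s \<omega>)\<^sup>2)
               \<partial>time_measure t) \<partial>M) \<longlonglongrightarrow> 0 \<and>
        (\<lambda>k. \<integral>\<^sup>+\<omega>. ennreal ((I \<omega> - simple_ito W (n k) (\<tau> k) (\<phi> k) \<omega>)\<^sup>2) \<partial>M) \<longlonglongrightarrow> 0)"


section \<open>The control problem\<close>

text \<open>The record fields \<open>b_y\<close>, \<open>b_u\<close>, \<open>b_m\<close> are the coefficient functions of the drift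
  \<open>b(t,y,u) = b_y'(t) y + b_u'(t) u + m(t)\<close>; \<open>cost_h\<close>, \<open>cost_j\<close>, \<open>cost_k\<close> are \<open>h\<close>, \<open>j\<close>, \<open>k\<close>.\<close>

record control_problem =
  horizon :: real
  y_init :: real
  b_y :: "real \<Rightarrow> real"
  b_u :: "real \<Rightarrow> real"
  b_m :: "real \<Rightarrow> real"
  diffusion :: "real \<Rightarrow> real \<Rightarrow> real"
  cost_h :: "real \<Rightarrow> real"
  cost_j :: "real \<Rightarrow> real"
  cost_k :: "real \<Rightarrow> real"

definition drift :: "control_problem \<Rightarrow> real \<Rightarrow> real \<Rightarrow> real \<Rightarrow> real" where
  "drift P t y u = b_y P t * y + b_u P t * u + b_m P t"

definition diffusion_y :: "control_problem \<Rightarrow> real \<Rightarrow> real \<Rightarrow> real" where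
  "diffusion_y P y u = deriv (\<lambda>z. diffusion P z u) y"

definition diffusion_u :: "control_problem \<Rightarrow> real \<Rightarrow> real \<Rightarrow> real" where
  "diffusion_u P y u = deriv (\<lambda>v. diffusion P y v) u"

definition C1_linear_growth :: "(real \<Rightarrow> real) \<Rightarrow> bool" where
  "C1_linear_growth f \<longleftrightarrow>
     (\<forall>x. f differentiable (at x)) \<and> continuous_on UNIV (deriv f) \<and>
     (\<exists>C. \<forall>x. \<bar>deriv f x\<bar> \<le> C * (1 + \<bar>x\<bar>))"

text \<open>In \<open>data_assumptions\<close>, \<open>dby\<close> and \<open>dbu\<close> are the time derivatives (one-sided at the end
  points) of \<open>b_y\<close> and \<open>b_u\<close>.\<close>

definition data_assumptions :: "control_problem \<Rightarrow> bool" where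
  "data_assumptions P \<longleftrightarrow>
     (\<exists>C\<^sub>b>0. \<exists>c\<^sub>b>0. \<forall>t\<in>{0..horizon P}. \<bar>b_y P t\<bar> + \<bar>b_u P t\<bar> \<le> C\<^sub>b \<and> c\<^sub>b \<le> \<bar>b_u P t\<bar>) \<and>
     (\<exists>C\<^sub>t>0. \<exists>dby dbu. \<forall>t\<in>{0..horizon P}.
        (b_y P has_real_derivative dby t) (at t within {0..horizon P}) \<and>
        (b_u P has_real_derivative dbu t) (at t within {0..horizon P}) \<and>
        \<bar>dby t\<bar> + \<bar>dbu t\<bar> \<le> C\<^sub>t) \<and>
     (\<forall>p. (\<lambda>(y, u). diffusion P y u) differentiable (at p)) \<and>
     continuous_on UNIV (\<lambda>(y, u). diffusion_y P y u) \<and>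
     continuous_on UNIV (\<lambda>(y, u). diffusion_u P y u) \<and>
     (\<exists>C\<^sub>\<sigma>>0. \<forall>y u. \<bar>diffusion_y P y u\<bar> + \<bar>diffusion_u P y u\<bar> \<le> C\<^sub>\<sigma>) \<and>
     C1_linear_growth (cost_h P) \<and> C1_linear_growth (cost_j P) \<and> C1_linear_growth (cost_k P)"

text \<open>Integrability of the drift along almost every path is part of being a solution; this is
  the only regularity imposed on the inhomogeneity \<open>b_m\<close>.\<close>

definition state_solution ::
    "'a measure \<Rightarrow> (real \<Rightarrow> 'a measure) \<Rightarrow> (real \<Rightarrow> 'a \<Rightarrow> real) \<Rightarrow> control_problem \<Rightarrow>
     (real \<Rightarrow> real) \<Rightarrow> (real \<Rightarrow> 'a \<Rightarrow> real) \<Rightarrow> bool" where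
  "state_solution M F W P u y \<longleftrightarrow>
     progressive F (horizon P) y \<and>
     (AE \<omega> in M. continuous_on {0..horizon P} (\<lambda>t. y t \<omega>)) \<and>
     (\<integral>\<^sup>+t. (\<integral>\<^sup>+\<omega>. ennreal ((y t \<omega>)\<^sup>2) \<partial>M) \<partial>time_measure (horizon P)) < \<infinity> \<and>
     (AE \<omega> in M. integrable (time_measure (horizon P)) (\<lambda>s. drift P s (y s \<omega>) (u s))) \<and>
     (\<forall>t\<in>{0..horizon P}. \<exists>I. has_ito_integral M F W t (\<lambda>s \<omega>. diffusion P (y s \<omega>) (u s)) I \<and>
        (AE \<omega> in M. y t \<omega> = y_init P + (\<integral>s. drift P s (y s \<omega>) (u s) \<partial>time_measure t) + I \<omega>))"

definition state_map ::
    "'a measure \<Rightarrow> (real \<Rightarrow> 'a measure) \<Rightarrow> (real \<Rightarrow> 'a \<Rightarrow> real) \<Rightarrow> control_problem \<Rightarrow>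
     ((real \<Rightarrow> real) \<Rightarrow> real \<Rightarrow> 'a \<Rightarrow> real) \<Rightarrow> bool" where
  "state_map M F W P Y \<longleftrightarrow>
     (\<forall>u\<in>L2 (horizon P). state_solution M F W P u (Y u) \<and>
        (\<forall>z. state_solution M F W P u z \<longrightarrow>
           (AE \<omega> in M. \<forall>t\<in>{0..horizon P}. z t \<omega> = Y u t \<omega>)))"

definition cost ::
    "'a measure \<Rightarrow> control_problem \<Rightarrow> ((real \<Rightarrow> real) \<Rightarrow> real \<Rightarrow> 'a \<Rightarrow> real) \<Rightarrow>
     (real \<Rightarrow> real) \<Rightarrow> real" where
  "cost M P Y u =
     (\<integral>\<omega>. (\<integral>t. cost_h P (Y u t \<omega>) + cost_j P (u t) \<partial>time_measure (horizon P))
          + cost_k P (Y u (horizon P) \<omega>) \<partial>M)"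

definition admissible ::
    "'a measure \<Rightarrow> control_problem \<Rightarrow> ((real \<Rightarrow> real) \<Rightarrow> real \<Rightarrow> 'a \<Rightarrow> real) \<Rightarrow> real \<Rightarrow>
     (real \<Rightarrow> real) set" where
  "admissible M P Y \<delta> =
     {u \<in> L2 (horizon P). (\<integral>t. (\<integral>\<omega>. Y u t \<omega> \<partial>M) \<partial>time_measure (horizon P)) \<le> \<delta>}"


section \<open>Piecewise constant controls\<close>

definition node :: "real \<Rightarrow> nat \<Rightarrow> nat \<Rightarrow> real" where
  "node T N n = real n * (T / real N)"

definition cell :: "real \<Rightarrow> nat \<Rightarrow> nat \<Rightarrow> real set" where
  "cell T N n = (if Suc n < N then {node T N n..<node T N (Suc n)}
                 else {node T N n..node T N (Suc n)})"

definition step_controls :: "real \<Rightarrow> nat \<Rightarrow> (real \<Rightarrow> real) set" where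
  "step_controls T N =
     {u \<in> L2 T. \<forall>n<N. \<exists>c. AE t in time_measure T. t \<in> cell T N n \<longrightarrow> u t = c}"

text \<open>The value \<open>u(t\<^sub>n)\<close> of a class \<open>u \<in> U\<^sub>N\<close>, independent of the representative.\<close>

definition cell_value :: "real \<Rightarrow> nat \<Rightarrow> (real \<Rightarrow> real) \<Rightarrow> nat \<Rightarrow> real" where
  "cell_value T N u n = (THE c. AE t in time_measure T. t \<in> cell T N n \<longrightarrow> u t = c)"


section \<open>The least squares Monte Carlo gradient\<close>

text \<open>The data of the scheme for one \<open>N\<close>: \<open>eta n k\<close> for \<open>k = 1..size_eta\<close> and \<open>xi n k\<close> for
  \<open>k = 1..size_xi\<close> are the basis functions at time \<open>t\<^sub>n\<close>, and \<open>noise l n\<close> is the \<open>n\<close>-th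
  increment (over \<open>[t\<^bsub>n-1\<^esub>, t\<^sub>n]\<close>) of the sample path \<open>l = 1..sample_size\<close>.\<close>

record 's lsmc =
  sample_size :: nat
  size_eta :: nat
  size_xi :: nat
  eta :: "nat \<Rightarrow> nat \<Rightarrow> real \<Rightarrow> real"
  xi :: "nat \<Rightarrow> nat \<Rightarrow> real \<Rightarrow> real"
  noise :: "nat \<Rightarrow> nat \<Rightarrow> 's \<Rightarrow> real"

definition independent_copies ::
    "'s measure \<Rightarrow> 'a measure \<Rightarrow> (real \<Rightarrow> 'a \<Rightarrow> real) \<Rightarrow> real \<Rightarrow> nat \<Rightarrow> 's lsmc \<Rightarrow> bool" where
  "independent_copies S M W T N D \<longleftrightarrow>
     prob_space.indep_vars S (\<lambda>_. PiM {1..N} (\<lambda>_. borel))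
       (\<lambda>l \<omega>. \<lambda>n\<in>{1..N}. noise D l n \<omega>) {1..sample_size D} \<and>
     (\<forall>l\<in>{1..sample_size D}.
        distr S (PiM {1..N} (\<lambda>_. borel)) (\<lambda>\<omega>. \<lambda>n\<in>{1..N}. noise D l n \<omega>) =
        distr M (PiM {1..N} (\<lambda>_. borel))
          (\<lambda>\<omega>. \<lambda>n\<in>{1..N}. W (node T N n) \<omega> - W (node T N (n - 1)) \<omega>))"

primrec euler_path ::
    "control_problem \<Rightarrow> nat \<Rightarrow> (real \<Rightarrow> real) \<Rightarrow> (nat \<Rightarrow> real) \<Rightarrow> nat \<Rightarrow> real" where
  "euler_path P N u dW 0 = y_init P"
| "euler_path P N u dW (Suc n) =
     euler_path P N u dW n
     + drift P (node (horizon P) N n) (euler_path P N u dW n) (cell_value (horizon P) N u n)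
         * (horizon P / real N)
     + diffusion P (euler_path P N u dW n) (cell_value (horizon P) N u n) * dW (Suc n)"

definition sample_path ::
    "control_problem \<Rightarrow> nat \<Rightarrow> 's lsmc \<Rightarrow> 's \<Rightarrow> (real \<Rightarrow> real) \<Rightarrow> nat \<Rightarrow> nat \<Rightarrow> real" where
  "sample_path P N D \<omega> u l n = euler_path P N u (\<lambda>i. noise D l i \<omega>) n"

definition basis_comb :: "nat \<Rightarrow> (nat \<Rightarrow> real \<Rightarrow> real) \<Rightarrow> (nat \<Rightarrow> real) \<Rightarrow> real \<Rightarrow> real" where
  "basis_comb K \<eta> \<alpha> y = (\<Sum>k=1..K. \<eta> k y * \<alpha> k)"

definition P_hat ::
    "control_problem \<Rightarrow> nat \<Rightarrow> 's lsmc \<Rightarrow> (nat \<Rightarrow> nat \<Rightarrow> real) \<Rightarrow> nat \<Rightarrow> real \<Rightarrow> real" where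
  "P_hat P N D \<alpha>\<^sub>0 n =
     (if n = N then deriv (cost_k P) else basis_comb (size_eta D) (eta D n) (\<alpha>\<^sub>0 n))"

definition Q_hat :: "'s lsmc \<Rightarrow> (nat \<Rightarrow> nat \<Rightarrow> real) \<Rightarrow> nat \<Rightarrow> real \<Rightarrow> real" where
  "Q_hat D \<alpha>\<^sub>1 n = basis_comb (size_xi D) (xi D n) (\<alpha>\<^sub>1 n)"

definition f_hat ::
    "control_problem \<Rightarrow> real \<Rightarrow> real \<Rightarrow> real \<Rightarrow> real \<Rightarrow> real \<Rightarrow> real" where
  "f_hat P t y p q u = deriv (cost_h P) y + p * b_y P t + q * diffusion_y P y u"

text \<open>The coefficient vectors are minimizers of the two regression problems. Minimizers need not
  be unique; any choice is allowed. Entries with index outside \<open>1..size_eta\<close> and \<open>1..size_xi\<close>,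
  respectively, play no role.\<close>

definition regression_coeffs ::
    "control_problem \<Rightarrow> nat \<Rightarrow> 's lsmc \<Rightarrow> 's \<Rightarrow> (real \<Rightarrow> real) \<Rightarrow>
     (nat \<Rightarrow> nat \<Rightarrow> real) \<Rightarrow> (nat \<Rightarrow> nat \<Rightarrow> real) \<Rightarrow> bool" where
  "regression_coeffs P N D \<omega> u \<alpha>\<^sub>0 \<alpha>\<^sub>1 \<longleftrightarrow>
     (let y = sample_path P N D \<omega> u; dt = horizon P / real N; L = sample_size D in
      \<forall>n<N.
        is_arg_min
          (\<lambda>\<alpha>. 1 / real L * (\<Sum>l=1..L.
             (noise D l (Suc n) \<omega> / dt * P_hat P N D \<alpha>\<^sub>0 (Suc n) (y l (Suc n))
              - basis_comb (size_xi D) (xi D n) \<alpha> (y l n))\<^sup>2))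
          (\<lambda>_. True) (\<alpha>\<^sub>1 n) \<and>
        is_arg_min
          (\<lambda>\<alpha>. 1 / real L * (\<Sum>l=1..L.
             (P_hat P N D \<alpha>\<^sub>0 (Suc n) (y l (Suc n))
              + f_hat P (node (horizon P) N n) (y l n) (P_hat P N D \<alpha>\<^sub>0 (Suc n) (y l (Suc n)))
                  (Q_hat D \<alpha>\<^sub>1 n (y l n)) (cell_value (horizon P) N u n) * dt
              - basis_comb (size_eta D) (eta D n) \<alpha> (y l n))\<^sup>2))
          (\<lambda>_. True) (\<alpha>\<^sub>0 n))"

definition lsmc_gradient ::
    "control_problem \<Rightarrow> nat \<Rightarrow> 's lsmc \<Rightarrow> 's \<Rightarrow> (nat \<Rightarrow> nat \<Rightarrow> real) \<Rightarrow> (nat \<Rightarrow> nat \<Rightarrow> real) \<Rightarrow>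
     (real \<Rightarrow> real) \<Rightarrow> real \<Rightarrow> real" where
  "lsmc_gradient P N D \<omega> \<alpha>\<^sub>0 \<alpha>\<^sub>1 u t =
     (let y = sample_path P N D \<omega> u; c = cell_value (horizon P) N u; L = sample_size D in
      \<Sum>n<N. indicator (cell (horizon P) N n) t *
        (1 / real L * (\<Sum>l=1..L.
            P_hat P N D \<alpha>\<^sub>0 n (y l n) * b_u P (node (horizon P) N n)
            + Q_hat D \<alpha>\<^sub>1 n (y l n) * diffusion_u P (y l n) (c n))
         + deriv (cost_j P) (c n)))"

end

theory Submission
  imports Defs
begin

text \<open>
  Write \<open>G u\<close> for the time integral of the mean state, so that the admissible controls are those
  with \<open>G u \<le> \<delta>\<close>, and \<open>\<Delta>\<close> for the step size \<open>T / N\<close>.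

  \<^emph>\<open>The constraint is a half-space with a regular normal.\<close> Ito integrals have mean zero
  (\<open>ito_integral_mean_zero\<close>) and the drift is affine in state and control, so the difference \<open>D\<close> of
  the mean states of two controls solves the linear equation \<open>D' = b\<^sub>y D + b\<^sub>u (u - v)\<close>, \<open>D 0 = 0\<close>, in
  integral form (\<open>mean_difference_volterra\<close>). Pairing it with the adjoint solution
  \<open>\<psi>' = - (b\<^sub>y \<psi> + 1)\<close>, \<open>\<psi> T = 0\<close>, yields \<open>G u - G v = (\<phi>, u - v)\<close> with \<open>\<phi> = b\<^sub>u \<psi>\<close>
  (\<open>volterra_duality\<close>, \<open>mean_state_affine\<close>). Here \<open>\<phi>\<close> is Lipschitz, and it has no zero on \<open>[0,T)\<close>
  because \<open>b\<^sub>u\<close> is bounded away from zero and \<open>\<psi>\<close> is positive there; hence its integral is not zero.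

  \<^emph>\<open>Consistency of second order.\<close> The cell averages of the optimal control \<open>u*\<close> are at distance
  \<open>O(\<Delta>)\<close> from \<open>u*\<close>, but tested against a Lipschitz function the error is only \<open>O(\<Delta>\<^sup>2)\<close>, since it is
  orthogonal to all step functions (\<open>average_superconvergence\<close>). They may violate the constraint,
  though by no more than \<open>O(\<Delta>\<^sup>2)\<close>; subtracting a constant of that size times the sign of \<open>\<integral>\<phi>\<close> makes
  them feasible. The result is a feasible step control \<open>p\<close> with \<open>\<parallel>p - u*\<parallel> = O(\<Delta>)\<close> and
  \<open>(J'(u*), p - u*) = O(\<Delta>\<^sup>2)\<close> (\<open>feasible_step_approximation\<close>).

  \<^emph>\<open>Perturbed contraction.\<close> Test the projection inequality that defines the next iterate \<open>w\<close> with
  \<open>p\<close>, and the first order condition at \<open>u*\<close> with \<open>w\<close>, which is admissible. With \<open>a\<close> and \<open>b\<close> the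
  distances of the current and the next iterate to \<open>u*\<close>, \<open>s = \<Delta> + \<epsilon>\<^sub>N\<close>, and \<open>\<kappa> < 1\<close> the contraction factor
  of the exact gradient step, this gives
  \<open>b\<^sup>2 \<le> b C s + (\<kappa> a + \<rho> s) (C s + b) + \<rho> C s\<^sup>2\<close>. Young's inequality turns it into
  \<open>b\<^sup>2 \<le> \<theta> a\<^sup>2 + c s\<^sup>2\<close> with \<open>\<theta> < 1\<close>, and iteration gives a limit superior of order \<open>s\<close>. That
  \<open>(J'(u*), p - u*)\<close> is of second order is essential: it enters under the square, so a first order
  bound would only give the rate \<open>\<Delta>\<^bsup>1/2\<^esup>\<close>.
\<close>

section \<open>The Hilbert space structure of \<open>L\<^sup>2([0,T])\<close>\<close>

lemma integrable_mult_of_square_integrable: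
  fixes f g :: "'b \<Rightarrow> real"
  assumes [measurable]: "f \<in> borel_measurable Q" "g \<in> borel_measurable Q"
    and "integrable Q (\<lambda>x. (f x)\<^sup>2)" "integrable Q (\<lambda>x. (g x)\<^sup>2)"
  shows "integrable Q (\<lambda>x. f x * g x)"
proof (rule Bochner_Integration.integrable_bound[where f = "\<lambda>x. (f x)\<^sup>2 + (g x)\<^sup>2"])
  have "\<bar>f x * g x\<bar> \<le> (f x)\<^sup>2 + (g x)\<^sup>2" for x
  proof -
    have "0 \<le> (\<bar>f x\<bar> - \<bar>g x\<bar>)\<^sup>2" "0 \<le> \<bar>f x\<bar> * \<bar>g x\<bar>" by auto
    thus ?thesis unfolding power2_diff abs_mult power2_abs by linarith
  qed
  thus "AE x in Q. norm (f x * g x) \<le> norm ((f x)\<^sup>2 + (g x)\<^sup>2)" by simp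
qed (use assms in auto)

text \<open>The quadratic polynomial \<open>r \<mapsto> \<integral> (r f + g)\<^sup>2\<close> is nonnegative, so its discriminant is not
  positive.\<close>

lemma integral_mult_le_squares:
  fixes f g :: "'b \<Rightarrow> real"
  assumes [measurable]: "f \<in> borel_measurable Q" "g \<in> borel_measurable Q"
    and f: "integrable Q (\<lambda>x. (f x)\<^sup>2)" and g: "integrable Q (\<lambda>x. (g x)\<^sup>2)"
  shows "(\<integral>x. f x * g x \<partial>Q)\<^sup>2 \<le> (\<integral>x. (f x)\<^sup>2 \<partial>Q) * (\<integral>x. (g x)\<^sup>2 \<partial>Q)"
proof -
  let ?a = "\<integral>x. (f x)\<^sup>2 \<partial>Q" and ?b = "\<integral>x. f x * g x \<partial>Q" and ?c = "\<integral>x. (g x)\<^sup>2 \<partial>Q"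
  have fg: "integrable Q (\<lambda>x. f x * g x)"
    by (rule integrable_mult_of_square_integrable) (use assms in auto)
  have quad: "0 \<le> r\<^sup>2 * ?a + 2 * r * ?b + ?c" for r
  proof -
    have "0 \<le> (\<integral>x. (r * f x + g x)\<^sup>2 \<partial>Q)" by simp
    also have "\<dots> = (\<integral>x. r\<^sup>2 * (f x)\<^sup>2 + 2 * r * (f x * g x) + (g x)\<^sup>2 \<partial>Q)"
      by (intro Bochner_Integration.integral_cong) (auto simp: power2_eq_square algebra_simps)
    also have "\<dots> = r\<^sup>2 * ?a + 2 * r * ?b + ?c" using f g fg by simp
    finally show ?thesis .
  qed
  have a: "0 \<le> ?a" by simp
  show ?thesis
  proof (cases "?a = 0")
    case True
    have "?b = 0"
    proof (rule ccontr)
      assume "?b \<noteq> 0"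
      with quad[of "- (?c + 1) / (2 * ?b)"] True show False by (simp add: field_simps)
    qed
    thus ?thesis by simp
  next
    case False
    hence "0 < ?a" using a by linarith
    moreover from this have "0 \<le> ?c - ?b\<^sup>2 / ?a"
      using quad[of "- ?b / ?a"] by (simp add: power2_eq_square field_simps)
    ultimately show ?thesis by (simp add: field_simps)
  qed
qed

lemma finite_measure_time_measure: "finite_measure (time_measure T)"
  by (rule finite_measureI) (cases "0 \<le> T"; simp add: emeasure_restrict_space space_restrict_space)

lemma space_time_measure [simp]: "space (time_measure T) = {0..T}"
  by (simp add: space_restrict_space)

lemma L2_measurable: "u \<in> L2 T \<Longrightarrow> u \<in> borel_measurable (time_measure T)"
  by (simp add: L2_def)

lemma L2_mult_integrable:
  "u \<in> L2 T \<Longrightarrow> v \<in> L2 T \<Longrightarrow> integrable (time_measure T) (\<lambda>t. u t * v t)"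
  unfolding L2_def by (intro integrable_mult_of_square_integrable) auto

lemma L2_cmult: "u \<in> L2 T \<Longrightarrow> (\<lambda>t. c * u t) \<in> L2 T"
  unfolding L2_def by (auto simp: power_mult_distrib)

lemma L2_add: 
  assumes "u \<in> L2 T" "v \<in> L2 T"
  shows "(\<lambda>t. u t + v t) \<in> L2 T"
proof -
  have "integrable (time_measure T) (\<lambda>t. (u t)\<^sup>2 + (v t)\<^sup>2 + 2 * (u t * v t))"
    using assms L2_mult_integrable[OF assms] by (auto simp: L2_def)
  thus ?thesis using assms by (auto simp: L2_def power2_sum mult.assoc)
qed

lemma L2_diff: "u \<in> L2 T \<Longrightarrow> v \<in> L2 T \<Longrightarrow> (\<lambda>t. u t - v t) \<in> L2 T"
  using L2_add[OF _ L2_cmult[of v T "-1"], of u] by simp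

lemma L2_bounded:
  assumes u: "u \<in> borel_measurable (time_measure T)" and B: "\<And>t. t \<in> {0..T} \<Longrightarrow> \<bar>u t\<bar> \<le> B"
  shows "u \<in> L2 T"
proof -
  interpret finite_measure "time_measure T" by (rule finite_measure_time_measure)
  have "integrable (time_measure T) (\<lambda>t. (u t)\<^sup>2)"
  proof (rule integrable_const_bound[where B = "B\<^sup>2"])
    show "AE t in time_measure T. norm ((u t)\<^sup>2) \<le> B\<^sup>2"
      using power_mono[OF B abs_ge_zero, of _ 2] by (intro AE_I2) (simp)
  qed (use u in measurable)
  thus ?thesis using u by (simp add: L2_def)
qed

lemma measurable_time_measure_continuous:
  fixes f :: "real \<Rightarrow> real"
  assumes "continuous_on {0..T} f"
  shows "f \<in> borel_measurable (time_measure T)"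
proof -
  have "f \<in> borel_measurable (restrict_space borel {0..T})"
    by (rule borel_measurable_continuous_on_restrict[OF assms])
  thus ?thesis by (simp cong: measurable_cong_sets add: sets_restrict_space)
qed

lemma continuous_on_Icc_bounded:
  fixes f :: "real \<Rightarrow> real"
  assumes "continuous_on {0..T} f"
  obtains B where "\<And>t. t \<in> {0..T} \<Longrightarrow> \<bar>f t\<bar> \<le> B"
proof -
  have "bounded (f ` {0..T})"
    using assms by (intro compact_imp_bounded compact_continuous_image) auto
  thus ?thesis using that unfolding bounded_iff by fastforce
qed

lemma L2_continuous:
  assumes "continuous_on {0..T} f"
  shows "f \<in> L2 T"
proof -
  obtain B where "\<And>t. t \<in> {0..T} \<Longrightarrow> \<bar>f t\<bar> \<le> B"
    using continuous_on_Icc_bounded[OF assms] by blast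
  thus ?thesis by (intro L2_bounded measurable_time_measure_continuous assms)
qed

lemma L2_const: "(\<lambda>t. c) \<in> L2 T"
  by (rule L2_continuous) simp

lemma L2_lipschitz_on: "C-lipschitz_on {0..T} f \<Longrightarrow> f \<in> L2 T"
  by (intro L2_continuous lipschitz_on_continuous_on)

lemma L2_integrable: "u \<in> L2 T \<Longrightarrow> integrable (time_measure T) u"
  using L2_mult_integrable[OF _ L2_const[of 1]] by simp

lemma L2_inner_commute: "L2_inner T u v = L2_inner T v u"
  by (simp add: L2_inner_def mult.commute)

lemma L2_inner_add_left:
  "u \<in> L2 T \<Longrightarrow> v \<in> L2 T \<Longrightarrow> w \<in> L2 T \<Longrightarrow>
    L2_inner T (\<lambda>t. u t + v t) w = L2_inner T u w + L2_inner T v w"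
  using L2_mult_integrable[of u T w] L2_mult_integrable[of v T w]
  by (simp add: L2_inner_def distrib_right)

lemma L2_inner_diff_left:
  "u \<in> L2 T \<Longrightarrow> v \<in> L2 T \<Longrightarrow> w \<in> L2 T \<Longrightarrow>
    L2_inner T (\<lambda>t. u t - v t) w = L2_inner T u w - L2_inner T v w"
  using L2_mult_integrable[of u T w] L2_mult_integrable[of v T w]
  by (simp add: L2_inner_def left_diff_distrib)

lemma L2_inner_cmult_left: "L2_inner T (\<lambda>t. c * u t) w = c * L2_inner T u w"
  by (simp add: L2_inner_def mult.assoc)

lemma L2_inner_add_right:
  "u \<in> L2 T \<Longrightarrow> v \<in> L2 T \<Longrightarrow> w \<in> L2 T \<Longrightarrow>
    L2_inner T w (\<lambda>t. u t + v t) = L2_inner T w u + L2_inner T w v"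
  using L2_inner_add_left by (simp add: L2_inner_commute[of T w])

lemma L2_inner_diff_right:
  "u \<in> L2 T \<Longrightarrow> v \<in> L2 T \<Longrightarrow> w \<in> L2 T \<Longrightarrow>
    L2_inner T w (\<lambda>t. u t - v t) = L2_inner T w u - L2_inner T w v"
  using L2_inner_diff_left by (simp add: L2_inner_commute[of T w])

lemma L2_inner_cmult_right: "L2_inner T w (\<lambda>t. c * u t) = c * L2_inner T w u"
  by (simp add: L2_inner_commute[of T w] L2_inner_cmult_left)

lemmas L2_closed = L2_add L2_diff L2_cmult

lemmas L2_inner_bilinear =
  L2_inner_add_left L2_inner_diff_left L2_inner_cmult_left
  L2_inner_add_right L2_inner_diff_right L2_inner_cmult_right

lemma L2_inner_self_nonneg: "0 \<le> L2_inner T u u"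
  by (simp add: L2_inner_def)

lemma L2_norm_nonneg: "0 \<le> L2_norm T u"
  by (simp add: L2_norm_def L2_inner_self_nonneg)

lemma L2_norm_squared: "(L2_norm T u)\<^sup>2 = L2_inner T u u"
  by (simp add: L2_norm_def L2_inner_self_nonneg)

lemma L2_cauchy_schwarz:
  assumes "u \<in> L2 T" "v \<in> L2 T"
  shows "\<bar>L2_inner T u v\<bar> \<le> L2_norm T u * L2_norm T v"
proof -
  have "(L2_inner T u v)\<^sup>2 \<le> L2_inner T u u * L2_inner T v v"
    using integral_mult_le_squares[of u "time_measure T" v] assms
    by (simp add: L2_inner_def L2_def power2_eq_square)
  hence "sqrt ((L2_inner T u v)\<^sup>2) \<le> sqrt (L2_inner T u u * L2_inner T v v)"
    by (rule real_sqrt_le_mono)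
  thus ?thesis by (simp add: L2_norm_def real_sqrt_mult)
qed

lemma L2_norm_triangle:
  assumes "u \<in> L2 T" "v \<in> L2 T"
  shows "L2_norm T (\<lambda>t. u t + v t) \<le> L2_norm T u + L2_norm T v"
proof (rule power2_le_imp_le)
  have "(L2_norm T (\<lambda>t. u t + v t))\<^sup>2 = (L2_norm T u)\<^sup>2 + 2 * L2_inner T u v + (L2_norm T v)\<^sup>2"
    using assms by (simp add: L2_norm_squared L2_inner_bilinear L2_closed L2_inner_commute[of T v u])
  also have "\<dots> \<le> (L2_norm T u + L2_norm T v)\<^sup>2"
    using L2_cauchy_schwarz[OF assms] by (simp add: power2_sum)
  finally show "(L2_norm T (\<lambda>t. u t + v t))\<^sup>2 \<le> (L2_norm T u + L2_norm T v)\<^sup>2" .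
qed (simp add: L2_norm_nonneg)

lemma L2_norm_diff_commute: "L2_norm T (\<lambda>t. u t - v t) = L2_norm T (\<lambda>t. v t - u t)"
  by (simp add: L2_norm_def L2_inner_def algebra_simps)

lemma L2_inner_cong_AE:
  assumes "u \<in> L2 T" "u' \<in> L2 T" "v \<in> L2 T" "v' \<in> L2 T"
    and "AE t in time_measure T. u t = u' t" "AE t in time_measure T. v t = v' t"
  shows "L2_inner T u v = L2_inner T u' v'"
  unfolding L2_inner_def
proof (rule integral_cong_AE)
  show "AE t in time_measure T. u t * v t = u' t * v' t" using assms(5,6) by eventually_elim simp
qed (use assms L2_measurable in \<open>auto intro!: borel_measurable_times\<close>)

lemma L2_norm_le_bound:
  assumes "0 \<le> T" "0 \<le> B" "u \<in> L2 T" and B: "\<And>t. t \<in> {0..T} \<Longrightarrow> \<bar>u t\<bar> \<le> B"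
  shows "L2_norm T u \<le> B * sqrt T"
proof -
  interpret finite_measure "time_measure T" by (rule finite_measure_time_measure)
  have "L2_inner T u u \<le> (\<integral>t. B * B \<partial>time_measure T)"
    unfolding L2_inner_def
  proof (rule integral_mono)
    fix t assume t: "t \<in> space (time_measure T)"
    show "u t * u t \<le> B * B"
      using mult_mono[OF B[of t] B[of t]] t assms(2) by (simp flip: abs_mult)
  qed (use L2_mult_integrable assms in auto)
  also have "\<dots> = B * B * T"
    using assms(1) by (simp add: measure_restrict_space)
  finally have "L2_norm T u \<le> sqrt (B * B * T)" unfolding L2_norm_def by simp
  thus ?thesis using assms(2) by (simp add: real_sqrt_mult)
qed

section \<open>Cell averages\<close>

lemma cell_cover:
  assumes "0 < T" "0 < N" "t \<in> {0..T}"
  shows "\<exists>n<N. t \<in> cell T N n"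
proof -
  define n where "n = nat \<lfloor>t / (T / real N)\<rfloor>"
  have d: "0 < T / real N" using assms by simp
  have x: "0 \<le> t / (T / real N)" using assms by simp
  have lo: "real n * (T / real N) \<le> t"
  proof -
    have "real n \<le> t / (T / real N)" unfolding n_def using x by linarith
    thus ?thesis by (simp only: pos_le_divide_eq[OF d])
  qed
  have hi: "t < real (Suc n) * (T / real N)"
  proof -
    have "t / (T / real N) < real (Suc n)" unfolding n_def using x by linarith
    thus ?thesis by (simp only: pos_divide_less_eq[OF d])
  qed
  show ?thesis
  proof (cases "n < N")
    case True
    have "t \<in> cell T N n" using lo hi unfolding cell_def node_def by (auto simp del: of_nat_Suc)
    with True show ?thesis by blast
  next
    case False
    hence "real N * (T / real N) \<le> real n * (T / real N)" using d by (intro mult_right_mono) auto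
    hence "T \<le> real n * (T / real N)" using assms by simp
    hence "t = T" using lo assms by simp
    moreover have "real (N - 1) * (T / real N) \<le> T" using assms by (simp add: field_simps)
    ultimately have "t \<in> cell T N (N - 1)"
      using assms by (auto simp: cell_def node_def)
    thus ?thesis using assms by (intro exI[of _ "N - 1"]) auto
  qed
qed

lemma node_mono: "0 < T \<Longrightarrow> m \<le> n \<Longrightarrow> node T N m \<le> node T N n"
  unfolding node_def by (intro mult_right_mono) auto

lemma cell_subset_Icc: "cell T N n \<subseteq> {node T N n..node T N (Suc n)}"
  unfolding cell_def by auto

lemma cell_subset: 
  assumes "0 < T" "n < N"
  shows "cell T N n \<subseteq> {0..T}"
proof -
  have "node T N 0 = 0" "node T N N = T" using assms by (auto simp: node_def)
  thus ?thesis using cell_subset_Icc[of T N n] node_mono[of T 0 n N] node_mono[of T "Suc n" N N] assms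
    by fastforce
qed

lemma cell_disjoint:
  assumes "0 < T" "m < N" "n < N" "t \<in> cell T N m" "t \<in> cell T N n"
  shows "m = n"
proof -
  have "n \<le> m" if "t \<in> cell T N m" "t \<in> cell T N n" "m < N" "n < N" for m n
  proof (rule ccontr)
    assume "\<not> n \<le> m"
    hence "Suc m \<le> n" by simp
    with that have "t < node T N (Suc m)" by (auto simp: cell_def split: if_splits)
    moreover have "node T N n \<le> t" using that cell_subset_Icc by fastforce
    ultimately show False using node_mono[OF assms(1) \<open>Suc m \<le> n\<close>, of N] by linarith
  qed
  from this[of m n] this[of n m] show ?thesis using assms by auto
qed

lemma sets_cell: "0 < T \<Longrightarrow> n < N \<Longrightarrow> cell T N n \<in> sets (time_measure T)"
  using cell_subset[of T n N]
  by (subst sets_restrict_space_iff) (auto simp: cell_def)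

lemma measure_cell: 
  assumes "0 < T" "n < N"
  shows "measure (time_measure T) (cell T N n) = T / real N"
proof -
  have "measure (time_measure T) (cell T N n) = measure lborel (cell T N n)"
    using cell_subset[OF assms] by (intro measure_restrict_space) auto
  also have "\<dots> = node T N (Suc n) - node T N n"
    using node_mono[of T n "Suc n" N] assms by (simp add: cell_def)
  also have "\<dots> = T / real N" by (simp add: node_def algebra_simps add_divide_distrib)
  finally show ?thesis .
qed

lemma sum_cells:
  assumes "0 < T" "n < N" "t \<in> cell T N n"
  shows "(\<Sum>m<N. indicator (cell T N m) t * f m) = (f n :: real)"
proof -
  have eq: "indicator (cell T N m) t * f m = (if n = m then f m else 0)" if "m < N" for m
    using cell_disjoint[OF assms(1) that assms(2) _ assms(3)] assms(3) by (cases "m = n") (auto simp: indicator_def)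
  have "(\<Sum>m<N. indicator (cell T N m) t * f m) = (\<Sum>m<N. if n = m then f m else 0)"
    by (intro sum.cong refl eq) simp
  also have "\<dots> = f n" using assms(2) by simp
  finally show ?thesis .
qed

definition step_function :: "real \<Rightarrow> nat \<Rightarrow> (nat \<Rightarrow> real) \<Rightarrow> real \<Rightarrow> real" where
  "step_function T N c t = (\<Sum>n<N. indicator (cell T N n) t * c n)"

lemma step_function_cell:
  "0 < T \<Longrightarrow> n < N \<Longrightarrow> t \<in> cell T N n \<Longrightarrow> step_function T N c t = c n"
  unfolding step_function_def by (rule sum_cells)

lemma L2_step_function:
  assumes "0 < T"
  shows "step_function T N c \<in> L2 T"
proof (rule L2_bounded)
  show "step_function T N c \<in> borel_measurable (time_measure T)"
    unfolding step_function_def using sets_cell[OF assms, of _ N] by measurable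
  fix t
  have "\<bar>step_function T N c t\<bar> \<le> (\<Sum>n<N. \<bar>indicator (cell T N n) t * c n\<bar>)"
    unfolding step_function_def by (rule sum_abs)
  also have "\<dots> \<le> (\<Sum>n<N. \<bar>c n\<bar>)" by (intro sum_mono) (auto simp: indicator_def)
  finally show "\<bar>step_function T N c t\<bar> \<le> (\<Sum>n<N. \<bar>c n\<bar>)" .
qed

lemma step_function_step_controls:
  assumes "0 < T"
  shows "step_function T N c \<in> step_controls T N"
  unfolding step_controls_def
  using L2_step_function[OF assms] step_function_cell[OF assms] by auto

definition cell_average :: "real \<Rightarrow> nat \<Rightarrow> (real \<Rightarrow> real) \<Rightarrow> nat \<Rightarrow> real" where
  "cell_average T N g n = (\<integral>t. indicator (cell T N n) t * g t \<partial>time_measure T) / (T / real N)"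

lemma integrable_indicator_cell:
  assumes "0 < T" "n < N" "integrable (time_measure T) g"
  shows "integrable (time_measure T) (\<lambda>t. indicator (cell T N n) t * g t :: real)"
  using integrable_mult_indicator[OF sets_cell[OF assms(1,2)] assms(3)] by simp

lemma integral_cell_const:
  assumes "0 < T" "n < N"
  shows "(\<integral>t. indicator (cell T N n) t * c \<partial>time_measure T) = T / real N * (c::real)"
  using measure_cell[OF assms] cell_subset[OF assms] by (simp add: Int_absorb1 Int_absorb2)

text \<open>The average is a mean of values \<open>g s\<close> with \<open>s\<close> in the same cell, hence at distance at most
  \<open>T / N\<close> from \<open>t\<close>.\<close>

lemma cell_average_deviation:
  assumes "0 < T" "n < N" and lip: "C-lipschitz_on {0..T} g" and t: "t \<in> cell T N n"
  shows "\<bar>g t - cell_average T N g n\<bar> \<le> C * (T / real N)"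
proof -
  interpret finite_measure "time_measure T" by (rule finite_measure_time_measure)
  let ?d = "T / real N" and ?I = "indicator (cell T N n) :: real \<Rightarrow> real"
  have d: "0 < ?d" using assms by simp
  have C: "0 \<le> C" using lip by (rule lipschitz_on_nonneg)
  have g: "integrable (time_measure T) (\<lambda>s. ?I s * g s)"
    using assms by (intro integrable_indicator_cell L2_integrable L2_lipschitz_on)
  have near: "\<bar>g s - g t\<bar> \<le> C * ?d" if "s \<in> cell T N n" for s
  proof -
    have "dist (g s) (g t) \<le> C * dist s t"
      using that t cell_subset[OF assms(1,2)] lip by (auto intro!: lipschitz_onD)
    also have "\<dots> \<le> C * ?d"
    proof (rule mult_left_mono[OF _ C])
      have "node T N (Suc n) - node T N n = ?d" by (simp add: node_def algebra_simps add_divide_distrib)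
      moreover have "s \<in> {node T N n..node T N (Suc n)}" "t \<in> {node T N n..node T N (Suc n)}"
        using that t cell_subset_Icc[of T N n] by auto
      ultimately show "dist s t \<le> ?d" by (auto simp: dist_real_def)
    qed
    finally show ?thesis by (simp add: dist_real_def)
  qed
  have K: "integrable (time_measure T) (\<lambda>s. ?I s * c)" for c
    using assms by (intro integrable_indicator_cell) auto
  have "(\<integral>s. ?I s * g s \<partial>time_measure T) \<le> (\<integral>s. ?I s * (g t + C * ?d) \<partial>time_measure T)"
    using near by (intro integral_mono g K) (fastforce simp: indicator_def)
  moreover have "(\<integral>s. ?I s * (g t - C * ?d) \<partial>time_measure T) \<le> (\<integral>s. ?I s * g s \<partial>time_measure T)"
    using near by (intro integral_mono g K) (fastforce simp: indicator_def)
  ultimately have "cell_average T N g n * ?d \<le> (g t + C * ?d) * ?d"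
    "(g t - C * ?d) * ?d \<le> cell_average T N g n * ?d"
    unfolding integral_cell_const[OF assms(1,2)] cell_average_def using d by (simp_all add: mult.commute)
  thus ?thesis unfolding mult_le_cancel_right_pos[OF d] by linarith
qed

lemma integral_split_cells:
  fixes h :: "real \<Rightarrow> real"
  assumes "0 < T" "0 < N" "integrable (time_measure T) h"
  shows "(\<integral>t. h t \<partial>time_measure T) = (\<Sum>n<N. \<integral>t. indicator (cell T N n) t * h t \<partial>time_measure T)"
proof -
  have "(\<integral>t. h t \<partial>time_measure T) = (\<integral>t. (\<Sum>n<N. indicator (cell T N n) t * h t) \<partial>time_measure T)"
  proof (rule Bochner_Integration.integral_cong[OF refl])
    fix t assume "t \<in> space (time_measure T)"
    then obtain n where "n < N" "t \<in> cell T N n" using cell_cover[OF assms(1,2)] by auto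
    thus "h t = (\<Sum>n<N. indicator (cell T N n) t * h t)"
      using sum_cells[OF assms(1), of n N t "\<lambda>_. h t"] by simp
  qed
  also have "\<dots> = (\<Sum>n<N. \<integral>t. indicator (cell T N n) t * h t \<partial>time_measure T)"
    using assms by (intro Bochner_Integration.integral_sum integrable_indicator_cell) auto
  finally show ?thesis .
qed

text \<open>On each cell \<open>a - g\<close> has integral zero, so \<open>f\<close> may be replaced by its deviation from its own
  average; then both factors are of first order in \<open>T / N\<close>.\<close>

lemma average_superconvergence:
  assumes "0 < T" "0 < N" and f: "A-lipschitz_on {0..T} f" and g: "B-lipschitz_on {0..T} g"
  defines "a \<equiv> step_function T N (cell_average T N g)"
  shows "\<bar>L2_inner T f (\<lambda>t. a t - g t)\<bar> \<le> A * B * T * (T / real N)\<^sup>2"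
proof -
  interpret finite_measure "time_measure T" by (rule finite_measure_time_measure)
  let ?d = "T / real N"
  have A: "0 \<le> A" and B: "0 \<le> B" using f g by (auto dest: lipschitz_on_nonneg)
  have L2: "f \<in> L2 T" "g \<in> L2 T" "a \<in> L2 T"
    using f g L2_step_function[OF assms(1)] by (auto intro: L2_lipschitz_on simp: a_def)
  have e: "(\<lambda>t. a t - g t) \<in> L2 T" by (intro L2_closed L2)
  have cell: "\<bar>\<integral>t. indicator (cell T N n) t * (f t * (a t - g t)) \<partial>time_measure T\<bar> \<le> A * B * ?d ^ 3"
    if n: "n < N" for n
  proof -
    let ?I = "indicator (cell T N n) :: real \<Rightarrow> real" and ?c = "cell_average T N f n"
    have i1: "integrable (time_measure T) (\<lambda>t. ?I t * (f t * (a t - g t)))"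
      using L2 e n assms(1) by (intro integrable_indicator_cell L2_mult_integrable)
    have i2: "integrable (time_measure T) (\<lambda>t. ?I t * (a t - g t))"
      using e n assms(1) by (intro integrable_indicator_cell L2_integrable)
    have ig: "integrable (time_measure T) (\<lambda>t. ?I t * g t)"
      using L2 n assms(1) by (intro integrable_indicator_cell L2_integrable)
    have ic: "integrable (time_measure T) (\<lambda>t. ?I t * c)" for c
      using n assms(1) by (intro integrable_indicator_cell) auto
    have "(\<integral>t. ?I t * (a t - g t) \<partial>time_measure T) =
        (\<integral>t. ?I t * cell_average T N g n - ?I t * g t \<partial>time_measure T)"
      using step_function_cell[OF assms(1) n] unfolding a_def
      by (intro Bochner_Integration.integral_cong) (auto simp: indicator_def)
    also have "\<dots> = ?d * cell_average T N g n - (\<integral>t. ?I t * g t \<partial>time_measure T)"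
      using integral_cell_const[OF assms(1) n] by (simp only: Bochner_Integration.integral_diff[OF ic ig])
    also have "\<dots> = 0" using assms(1,2) by (simp add: cell_average_def)
    finally have zero: "(\<integral>t. ?I t * (a t - g t) \<partial>time_measure T) = 0" .
    have centred: "(\<integral>t. ?I t * (f t * (a t - g t)) \<partial>time_measure T) =
        (\<integral>t. ?I t * (f t * (a t - g t)) - ?c * (?I t * (a t - g t)) \<partial>time_measure T)"
      using zero i1 i2 by simp
    have "norm (\<integral>t. ?I t * (f t * (a t - g t)) - ?c * (?I t * (a t - g t)) \<partial>time_measure T)
        \<le> (\<integral>t. ?I t * (A * B * ?d\<^sup>2) \<partial>time_measure T)"
    proof (rule Bochner_Integration.integral_norm_bound_integral)
      fix t assume "t \<in> space (time_measure T)"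
      show "norm (?I t * (f t * (a t - g t)) - ?c * (?I t * (a t - g t))) \<le> ?I t * (A * B * ?d\<^sup>2)"
      proof (cases "t \<in> cell T N n")
        case True
        have "\<bar>f t - ?c\<bar> * \<bar>a t - g t\<bar> \<le> (A * ?d) * (B * ?d)"
          using cell_average_deviation[OF assms(1) n f True] cell_average_deviation[OF assms(1) n g True]
            A assms(1) step_function_cell[OF assms(1) n True]
          by (intro mult_mono) (auto simp: a_def abs_minus_commute)
        hence "\<bar>(f t - ?c) * (a t - g t)\<bar> \<le> A * B * ?d\<^sup>2"
          by (simp add: abs_mult power2_eq_square mult_ac)
        thus ?thesis using True by (simp add: left_diff_distrib)
      qed simp
    qed (intro Bochner_Integration.integrable_diff integrable_mult_right i1 i2, rule ic)
    also have "\<dots> = A * B * ?d ^ 3"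
      unfolding integral_cell_const[OF assms(1) n] by (simp only: power2_eq_square power3_eq_cube mult_ac)
    finally show ?thesis unfolding centred real_norm_def .
  qed
  have split: "L2_inner T f (\<lambda>t. a t - g t) =
      (\<Sum>n<N. \<integral>t. indicator (cell T N n) t * (f t * (a t - g t)) \<partial>time_measure T)"
    unfolding L2_inner_def using assms(1,2) L2 e by (intro integral_split_cells L2_mult_integrable)
  have "\<bar>L2_inner T f (\<lambda>t. a t - g t)\<bar> \<le> (\<Sum>n<N. A * B * ?d ^ 3)"
    unfolding split by (intro order_trans[OF sum_abs] sum_mono cell) auto
  also have "\<dots> = A * B * T * ?d\<^sup>2"
  proof -
    have "(\<Sum>n<N. A * B * ?d ^ 3) = A * B * (real N * ?d) * ?d\<^sup>2"
      by (simp only: sum_constant card_lessThan power3_eq_cube power2_eq_square mult_ac)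
    thus ?thesis using assms(2) by simp
  qed
  finally show ?thesis .
qed

lemma average_convergence:
  assumes "0 < T" "0 < N" and g: "B-lipschitz_on {0..T} g"
  defines "a \<equiv> step_function T N (cell_average T N g)"
  shows "L2_norm T (\<lambda>t. a t - g t) \<le> B * (T / real N) * sqrt T"
proof (rule L2_norm_le_bound)
  show "0 \<le> B * (T / real N)" using lipschitz_on_nonneg[OF g] assms(1) by simp
  show "(\<lambda>t. a t - g t) \<in> L2 T" unfolding a_def
    by (intro L2_diff L2_step_function L2_lipschitz_on[OF g] assms(1))
  fix t assume "t \<in> {0..T}"
  then obtain n where n: "n < N" "t \<in> cell T N n" using cell_cover assms(1,2) by blast
  show "\<bar>a t - g t\<bar> \<le> B * (T / real N)"
    using cell_average_deviation[OF assms(1) n(1) g n(2)] step_function_cell[OF assms(1) n]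
    by (simp add: a_def abs_minus_commute)
qed (use assms in simp)

section \<open>The first order condition and feasible step controls\<close>

text \<open>A negative derivative in the direction \<open>v - u\<close> would make \<open>J\<close> smaller on the segment from
  \<open>u\<close> to \<open>v\<close>, on which \<open>u\<close> is minimal.\<close>

lemma minimizer_variational_inequality:
  assumes grad: "has_L2_gradient T J dJ" and u: "u \<in> L2 T" and v: "v \<in> L2 T"
    and min: "\<And>s. 0 < s \<Longrightarrow> s \<le> 1 \<Longrightarrow> J u \<le> J (\<lambda>t. u t + s * (v t - u t))"
  shows "0 \<le> L2_inner T (dJ u) (\<lambda>t. v t - u t)"
proof -
  define w where "w = (\<lambda>t. v t - u t)"
  have w: "w \<in> L2 T" unfolding w_def by (intro L2_closed u v)
  have bound: "- (e * L2_norm T w) \<le> L2_inner T (dJ u) w" if e: "0 < e" for e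
  proof -
    from grad u e obtain d where d: "0 < d" and approx: "\<And>h. h \<in> L2 T \<Longrightarrow> L2_norm T h < d \<Longrightarrow>
        \<bar>J (\<lambda>t. u t + h t) - J u - L2_inner T (dJ u) h\<bar> \<le> e * L2_norm T h"
      unfolding has_L2_gradient_def by blast
    \<comment> \<open>The \<open>+ 1\<close> keeps the quotient meaningful for \<open>w = 0\<close>; the factor 2 makes \<open>\<parallel>s w\<parallel> < d\<close> strict.\<close>
    define s where "s = min 1 (d / (2 * (L2_norm T w + 1)))"
    have n: "0 < L2_norm T w + 1" using L2_norm_nonneg[of T w] by simp
    have s: "0 < s" "s \<le> 1" using d n by (auto simp: s_def)
    have sn: "L2_norm T (\<lambda>t. s * w t) = s * L2_norm T w"
      using s by (simp add: L2_norm_def L2_inner_bilinear real_sqrt_mult)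
    have "s * (L2_norm T w + 1) \<le> d / (2 * (L2_norm T w + 1)) * (L2_norm T w + 1)"
      using n by (intro mult_right_mono) (auto simp: s_def)
    also have "\<dots> = d / 2" using n by (simp add: field_simps)
    finally have "s * L2_norm T w < d" using s d by (simp add: algebra_simps)
    hence "\<bar>J (\<lambda>t. u t + s * w t) - J u - s * L2_inner T (dJ u) w\<bar> \<le> e * (s * L2_norm T w)"
      using approx[OF L2_cmult[OF w, of s]] by (simp add: sn L2_inner_cmult_right)
    moreover have "J u \<le> J (\<lambda>t. u t + s * w t)" using min[OF s] by (simp add: w_def)
    ultimately have "0 \<le> s * (L2_inner T (dJ u) w + e * L2_norm T w)"
      by (simp add: algebra_simps)
    thus ?thesis using s by (simp add: zero_le_mult_iff)
  qed
  have "0 \<le> L2_inner T (dJ u) w"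
  proof (rule ccontr)
    assume neg: "\<not> 0 \<le> L2_inner T (dJ u) w"
    have n: "0 < L2_norm T w + 1" using L2_norm_nonneg[of T w] by simp
    define e where "e = - L2_inner T (dJ u) w / (L2_norm T w + 1)"
    have "e * (L2_norm T w + 1) = - L2_inner T (dJ u) w" using n by (simp add: e_def)
    moreover have "0 < e" using neg n unfolding e_def by (intro divide_pos_pos) auto
    ultimately show False using bound[of e] by (simp add: algebra_simps)
  qed
  thus ?thesis by (simp add: w_def)
qed

text \<open>The averages of \<open>u\<close> exceed the constraint value \<open>G u\<close> by at most \<open>A B T (T/N)\<^sup>2\<close>. Moving by a
  constant \<open>c\<close> changes \<open>G\<close> by exactly \<open>c \<integral>\<phi>\<close>, so a shift of second order restores feasibility and
  leaves both error bounds intact.\<close>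

lemma feasible_step_approximation:
  assumes T: "0 < T" and G: "\<And>v w. v \<in> L2 T \<Longrightarrow> w \<in> L2 T \<Longrightarrow> G v - G w = L2_inner T \<phi> (\<lambda>t. v t - w t)"
    and \<phi>: "A-lipschitz_on {0..T} \<phi>" and nz: "(\<integral>t. \<phi> t \<partial>time_measure T) \<noteq> 0"
    and u: "u \<in> L2 T" "L2_lipschitz T u" and q: "q \<in> L2 T" "L2_lipschitz T q"
  shows "\<exists>C\<ge>0. \<forall>N>0. \<exists>p\<in>step_controls T N. G p \<le> G u \<and>
    L2_norm T (\<lambda>t. p t - u t) \<le> C * (T / real N) \<and>
    L2_inner T q (\<lambda>t. p t - u t) \<le> C * (T / real N)\<^sup>2"
proof -
  obtain g B where g: "B-lipschitz_on {0..T} g" and ug: "AE t in time_measure T. u t = g t"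
    using u(2) by (auto simp: L2_lipschitz_def)
  obtain r R where r: "R-lipschitz_on {0..T} r" and qr: "AE t in time_measure T. q t = r t"
    using q(2) by (auto simp: L2_lipschitz_def)
  define m where "m = (\<integral>t. \<phi> t \<partial>time_measure T)"
  \<comment> \<open>Subtracting \<open>k (T/N)\<^sup>2\<close> times the sign of \<open>m\<close> lowers \<open>G\<close> by the largest possible excess.\<close>
  define k where "k = A * B * T / \<bar>m\<bar>"
  have nonneg: "0 \<le> A" "0 \<le> B" "0 \<le> R" using \<phi> g r by (auto dest: lipschitz_on_nonneg)
  have k: "0 \<le> k" "k * \<bar>m\<bar> = A * B * T" using nonneg T nz by (auto simp: k_def m_def)
  define C where "C = B * sqrt T + k * T * sqrt T + R * B * T + k * \<bar>\<integral>t. r t \<partial>time_measure T\<bar>"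
  show ?thesis
  proof (intro exI[of _ C] conjI allI impI)
    show "0 \<le> C" using nonneg k T by (simp add: C_def)
    fix N :: nat assume N: "0 < N"
    let ?d = "T / real N"
    have d: "0 < ?d" using T N by simp
    have "T * 1 \<le> T * real N" using T N by (intro mult_left_mono) auto
    hence dT: "?d \<le> T" using T N by (simp add: divide_le_eq)
    define a where "a = step_function T N (cell_average T N g)"
    define c where "c = k * ?d\<^sup>2 * sgn m"
    define p where "p = step_function T N (\<lambda>n. cell_average T N g n - c)"
    have L2: "a \<in> L2 T" "p \<in> L2 T" "g \<in> L2 T" "r \<in> L2 T" "\<phi> \<in> L2 T"
      using L2_step_function[OF T] g r \<phi> by (auto intro: L2_lipschitz_on simp: a_def p_def)
    have abs_c: "\<bar>c\<bar> \<le> k * ?d\<^sup>2" using k by (simp add: c_def abs_mult sgn_if)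
    have pa: "p t = a t - c" if "t \<in> {0..T}" for t
      using cell_cover[OF T N that] step_function_cell[OF T] by (auto simp: a_def p_def)
    have diff: "AE t in time_measure T. p t - u t = (a t - g t) - c"
      using ug AE_space by eventually_elim (use pa in auto)
    have inner: "L2_inner T f (\<lambda>t. p t - u t) =
        L2_inner T f (\<lambda>t. a t - g t) - c * (\<integral>t. f t \<partial>time_measure T)" if f: "f \<in> L2 T" for f
    proof -
      have "L2_inner T f (\<lambda>t. p t - u t) = L2_inner T f (\<lambda>t. (a t - g t) - c)"
        by (rule L2_inner_cong_AE) (auto intro!: L2_closed L2 L2_const f u simp: diff)
      also have "\<dots> = L2_inner T f (\<lambda>t. a t - g t) - L2_inner T f (\<lambda>t. c)"
        by (intro L2_inner_diff_right L2_closed L2 L2_const f)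
      finally show ?thesis by (simp add: L2_inner_def mult.commute)
    qed
    have "L2_norm T (\<lambda>t. p t - u t) = L2_norm T (\<lambda>t. (a t - g t) + - c)"
      unfolding L2_norm_def by (intro arg_cong[where f = sqrt] L2_inner_cong_AE)
        (use diff in \<open>auto intro!: L2_closed L2 L2_const u\<close>)
    also have "\<dots> \<le> L2_norm T (\<lambda>t. a t - g t) + L2_norm T (\<lambda>t. - c)"
      by (intro L2_norm_triangle L2_closed L2 L2_const)
    also have "\<dots> \<le> B * ?d * sqrt T + (k * ?d\<^sup>2) * sqrt T"
      unfolding a_def using T k abs_c
      by (intro add_mono average_convergence T N g L2_norm_le_bound L2_const) auto
    also have "\<dots> \<le> B * ?d * sqrt T + (k * (T * ?d)) * sqrt T"
      unfolding power2_eq_square using k d dT T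
      by (intro add_left_mono mult_right_mono mult_left_mono) auto
    also have "\<dots> = (B * sqrt T + k * T * sqrt T) * ?d" by (simp add: algebra_simps)
    also have "\<dots> \<le> C * ?d"
      using nonneg k T d by (intro mult_right_mono) (auto simp: C_def)
    finally have norm: "L2_norm T (\<lambda>t. p t - u t) \<le> C * ?d" .
    have "L2_inner T q (\<lambda>t. p t - u t) = L2_inner T r (\<lambda>t. p t - u t)"
      by (rule L2_inner_cong_AE) (auto intro!: L2_closed L2 u q simp: qr)
    also have "\<dots> \<le> R * B * T * ?d\<^sup>2 + k * ?d\<^sup>2 * \<bar>\<integral>t. r t \<partial>time_measure T\<bar>"
    proof -
      have "\<bar>L2_inner T r (\<lambda>t. a t - g t)\<bar> \<le> R * B * T * ?d\<^sup>2"
        unfolding a_def by (rule average_superconvergence[OF T N r g])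
      moreover have "\<bar>c * (\<integral>t. r t \<partial>time_measure T)\<bar> \<le> k * ?d\<^sup>2 * \<bar>\<integral>t. r t \<partial>time_measure T\<bar>"
        unfolding abs_mult using abs_c by (intro mult_right_mono) auto
      ultimately show ?thesis unfolding inner[OF L2(4)] by linarith
    qed
    also have "\<dots> = (R * B * T + k * \<bar>\<integral>t. r t \<partial>time_measure T\<bar>) * ?d\<^sup>2" by (simp add: algebra_simps)
    also have "\<dots> \<le> C * ?d\<^sup>2"
      using nonneg k T by (intro mult_right_mono) (auto simp: C_def)
    finally have second: "L2_inner T q (\<lambda>t. p t - u t) \<le> C * ?d\<^sup>2" .
    have "G p - G u = L2_inner T \<phi> (\<lambda>t. a t - g t) - c * m"
      using G[OF L2(2) u(1)] inner[OF L2(5)] by (simp add: m_def)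
    also have "\<dots> \<le> A * B * T * ?d\<^sup>2 - c * m"
      using average_superconvergence[OF T N \<phi> g] unfolding a_def by linarith
    also have "c * m = A * B * T * ?d\<^sup>2"
    proof -
      have "c * m = (k * \<bar>m\<bar>) * ?d\<^sup>2" by (simp add: c_def abs_sgn)
      thus ?thesis by (simp add: k(2))
    qed
    finally have "G p \<le> G u" by simp
    thus "\<exists>p\<in>step_controls T N. G p \<le> G u \<and> L2_norm T (\<lambda>t. p t - u t) \<le> C * ?d \<and>
        L2_inner T q (\<lambda>t. p t - u t) \<le> C * ?d\<^sup>2"
      using norm second step_function_step_controls[OF T] unfolding p_def by blast
  qed
qed

section \<open>The projected gradient iteration with inexact gradients\<close>

text \<open>Expanding the square gives the factor \<open>1 - 2 C\<^sub>2 \<rho> + C\<^sub>1\<^sup>2 \<rho>\<^sup>2\<close>, which is at most \<open>\<kappa>\<^sup>2\<close>.\<close>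

lemma gradient_step_contracts:
  assumes L2: "u \<in> L2 T" "v \<in> L2 T" "du \<in> L2 T" "dv \<in> L2 T" and "0 < \<rho>"
    and lip: "L2_norm T (\<lambda>t. du t - dv t) \<le> C\<^sub>1 * L2_norm T (\<lambda>t. u t - v t)"
    and mono: "C\<^sub>2 * (L2_norm T (\<lambda>t. u t - v t))\<^sup>2 \<le> L2_inner T (\<lambda>t. du t - dv t) (\<lambda>t. u t - v t)"
    and \<kappa>: "0 \<le> \<kappa>" "1 - 2 * C\<^sub>2 * \<rho> + (1 + 2 * C\<^sub>1\<^sup>2) * \<rho>\<^sup>2 = \<kappa>\<^sup>2"
  shows "L2_norm T (\<lambda>t. (u t - v t) - \<rho> * (du t - dv t)) \<le> \<kappa> * L2_norm T (\<lambda>t. u t - v t)"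
proof (rule power2_le_imp_le)
  define e where "e = (\<lambda>t. u t - v t)"
  define f where "f = (\<lambda>t. du t - dv t)"
  have ef: "e \<in> L2 T" "f \<in> L2 T" unfolding e_def f_def by (intro L2_closed L2)+
  have "(L2_norm T (\<lambda>t. e t - \<rho> * f t))\<^sup>2 =
      (L2_norm T e)\<^sup>2 - 2 * \<rho> * L2_inner T f e + \<rho>\<^sup>2 * (L2_norm T f)\<^sup>2"
    unfolding L2_norm_squared
    using ef by (simp add: L2_inner_bilinear L2_closed L2_inner_commute[of T e f]
      power2_eq_square algebra_simps)
  also have "\<dots> \<le> (L2_norm T e)\<^sup>2 - 2 * \<rho> * (C\<^sub>2 * (L2_norm T e)\<^sup>2) + \<rho>\<^sup>2 * (C\<^sub>1 * L2_norm T e)\<^sup>2"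
    using mono lip \<open>0 < \<rho>\<close> unfolding e_def[symmetric] f_def[symmetric]
    by (intro add_mono diff_mono mult_left_mono power_mono) (auto simp: L2_norm_nonneg)
  also have "\<dots> \<le> (1 - 2 * C\<^sub>2 * \<rho> + (1 + 2 * C\<^sub>1\<^sup>2) * \<rho>\<^sup>2) * (L2_norm T e)\<^sup>2"
  proof -
    have "0 \<le> (1 + C\<^sub>1\<^sup>2) * \<rho>\<^sup>2 * (L2_norm T e)\<^sup>2" by simp
    thus ?thesis by (simp add: algebra_simps power_mult_distrib)
  qed
  also have "\<dots> = (\<kappa> * L2_norm T e)\<^sup>2" by (simp add: \<kappa>(2) power_mult_distrib)
  finally show "(L2_norm T (\<lambda>t. (u t - v t) - \<rho> * (du t - dv t)))\<^sup>2 \<le>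
      (\<kappa> * L2_norm T (\<lambda>t. u t - v t))\<^sup>2"
    unfolding e_def f_def .
qed (simp add: \<kappa> L2_norm_nonneg)

text \<open>Bound \<open>a b\<close> by \<open>(a\<^sup>2 + b\<^sup>2) / 2\<close> and split the mixed terms \<open>s a\<close> and \<open>s b\<close> by Young's
  inequality with weight \<open>(1 - \<kappa>) / 4\<close>. The coefficients of \<open>a\<^sup>2\<close> and \<open>b\<^sup>2\<close> become \<open>(1 + \<kappa>) / 4\<close> and
  \<open>(3 - \<kappa>) / 4\<close>; the first is smaller than the second since \<open>\<kappa> < 1\<close>.\<close>

lemma scalar_error_recursion:
  fixes a b s :: real
  assumes nonneg: "0 \<le> a" "0 \<le> b" "0 \<le> s" "0 \<le> C" "0 < \<rho>" and \<kappa>: "0 \<le> \<kappa>" "\<kappa> < 1"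
    and bound: "b\<^sup>2 \<le> b * (C * s) + (\<kappa> * a + \<rho> * s) * (C * s + b) + \<rho> * (C * s\<^sup>2)"
  shows "b\<^sup>2 \<le> (1 + \<kappa>) / (3 - \<kappa>) * a\<^sup>2 +
    4 / (3 - \<kappa>) * (2 * (C + \<rho>)\<^sup>2 / (1 - \<kappa>) + 2 * \<rho> * C) * s\<^sup>2"
proof -
  define m where "m = (C + \<rho>) * s"
  have young: "m * x \<le> (1 - \<kappa>) / 4 * x\<^sup>2 + m\<^sup>2 / (1 - \<kappa>)" for x
  proof -
    have "0 \<le> ((1 - \<kappa>) / 2 * x - m)\<^sup>2 / (1 - \<kappa>)" using \<kappa> by simp
    also have "\<dots> = (1 - \<kappa>) / 4 * x\<^sup>2 - m * x + m\<^sup>2 / (1 - \<kappa>)"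
      using \<kappa> by (simp add: field_simps power2_eq_square)
    finally show ?thesis by simp
  qed
  have "\<kappa> * (a * b) \<le> \<kappa> * ((a\<^sup>2 + b\<^sup>2) / 2)"
    using \<kappa> sum_squares_bound[of a b] by (intro mult_left_mono) auto
  moreover have "\<kappa> * a * (C * s) \<le> m * a"
  proof -
    have "\<kappa> * a * (C * s) \<le> 1 * a * ((C + \<rho>) * s)"
      using nonneg \<kappa> by (intro mult_mono mult_right_mono) auto
    thus ?thesis by (simp add: m_def mult.commute)
  qed
  moreover have "b * (C * s) + (\<kappa> * a + \<rho> * s) * (C * s + b) + \<rho> * (C * s\<^sup>2) =
      \<kappa> * (a * b) + m * b + \<kappa> * a * (C * s) + 2 * \<rho> * C * s\<^sup>2"
    by (simp add: m_def algebra_simps power2_eq_square)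
  ultimately have "b\<^sup>2 \<le> \<kappa> * ((a\<^sup>2 + b\<^sup>2) / 2) + m * b + m * a + 2 * \<rho> * C * s\<^sup>2"
    using bound by linarith
  moreover have "(3 - \<kappa>) / 4 * b\<^sup>2 - (1 + \<kappa>) / 4 * a\<^sup>2 =
      b\<^sup>2 - \<kappa> * ((a\<^sup>2 + b\<^sup>2) / 2) - (1 - \<kappa>) / 4 * b\<^sup>2 - (1 - \<kappa>) / 4 * a\<^sup>2"
    by (simp add: field_simps)
  ultimately have "(3 - \<kappa>) / 4 * b\<^sup>2 \<le>
      (1 + \<kappa>) / 4 * a\<^sup>2 + 2 * (m\<^sup>2 / (1 - \<kappa>)) + 2 * \<rho> * C * s\<^sup>2"
    using young[of a] young[of b] by linarith
  also have "\<dots> = (1 + \<kappa>) / 4 * a\<^sup>2 + (2 * (C + \<rho>)\<^sup>2 / (1 - \<kappa>) + 2 * \<rho> * C) * s\<^sup>2"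
    unfolding m_def power_mult_distrib by (simp add: distrib_right)
  finally have "4 / (3 - \<kappa>) * ((3 - \<kappa>) / 4 * b\<^sup>2) \<le>
      4 / (3 - \<kappa>) * ((1 + \<kappa>) / 4 * a\<^sup>2 + (2 * (C + \<rho>)\<^sup>2 / (1 - \<kappa>) + 2 * \<rho> * C) * s\<^sup>2)"
    using \<kappa> by (intro mult_left_mono) auto
  moreover have "4 / q * (q / 4 * x) = x" "4 / q * (r / 4 * x + y * z) = r / q * x + 4 / q * y * z"
    if "q \<noteq> 0" for q r x y z :: real
    using that by (simp_all add: field_simps)
  ultimately show ?thesis using \<kappa> by simp
qed

text \<open>One step from \<open>v\<close> to \<open>w\<close>, for a gradient \<open>d\<close> that approximates the exact gradient \<open>dv\<close> at \<open>v\<close>;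
  \<open>ds\<close> is the gradient at the minimizer \<open>us\<close> and \<open>p\<close> is a feasible comparison point near \<open>us\<close>.\<close>

lemma projected_gradient_error:
  assumes L2: "us \<in> L2 T" "v \<in> L2 T" "w \<in> L2 T" "p \<in> L2 T"
      "ds \<in> L2 T" "dv \<in> L2 T" "d \<in> L2 T"
    and pos: "0 < \<rho>" "0 \<le> s" "0 \<le> C" and \<kappa>: "0 \<le> \<kappa>" "\<kappa> < 1"
    and proj: "0 \<le> L2_inner T (\<lambda>t. w t - (v t - \<rho> * d t)) (\<lambda>t. p t - w t)"
    and vi: "0 \<le> L2_inner T ds (\<lambda>t. w t - us t)"
    and contr: "L2_norm T (\<lambda>t. (us t - v t) - \<rho> * (ds t - dv t)) \<le> \<kappa> * L2_norm T (\<lambda>t. us t - v t)"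
    and err: "L2_norm T (\<lambda>t. dv t - d t) \<le> s"
    and near: "L2_norm T (\<lambda>t. p t - us t) \<le> C * s" "L2_inner T ds (\<lambda>t. p t - us t) \<le> C * s\<^sup>2"
  shows "(L2_norm T (\<lambda>t. us t - w t))\<^sup>2 \<le> (1 + \<kappa>) / (3 - \<kappa>) * (L2_norm T (\<lambda>t. us t - v t))\<^sup>2 +
    4 / (3 - \<kappa>) * (2 * (C + \<rho>)\<^sup>2 / (1 - \<kappa>) + 2 * \<rho> * C) * s\<^sup>2"
proof (rule scalar_error_recursion)
  let ?a = "L2_norm T (\<lambda>t. us t - v t)" and ?b = "L2_norm T (\<lambda>t. us t - w t)"
  define e where "e = (\<lambda>t. us t - w t)"
  define r where "r = (\<lambda>t. p t - w t)"
  define x where "x = (\<lambda>t. (us t - v t) - \<rho> * (ds t - dv t))"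
  define z where "z = (\<lambda>t. d t - dv t)"
  define y where "y = (\<lambda>t. us t - p t)"
  have mem: "e \<in> L2 T" "r \<in> L2 T" "x \<in> L2 T" "z \<in> L2 T" "y \<in> L2 T"
    unfolding e_def r_def x_def z_def y_def by (intro L2_closed L2)+
  \<comment> \<open>Insert \<open>p\<close>, then the projection inequality at \<open>w\<close>, then the gradients at \<open>v\<close> and at \<open>us\<close>:
    the last two terms have a sign, by the first order condition at \<open>us\<close> and by the projection
    inequality, and the others are small or carry the contraction factor.\<close>
  have split: "L2_inner T e e = L2_inner T e y + L2_inner T x r + \<rho> * L2_inner T z r
      + \<rho> * L2_inner T ds (\<lambda>t. p t - us t) - \<rho> * L2_inner T ds (\<lambda>t. w t - us t)
      - L2_inner T (\<lambda>t. w t - (v t - \<rho> * d t)) r"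
    unfolding e_def r_def x_def z_def y_def
    using L2 by (simp add: L2_inner_bilinear L2_closed L2_inner_commute[of T us w]
      L2_inner_commute[of T us p] L2_inner_commute[of T w p] algebra_simps)
  have "L2_norm T r \<le> C * s + ?b"
  proof -
    have "L2_norm T r = L2_norm T (\<lambda>t. (p t - us t) + (us t - w t))" by (simp add: r_def)
    also have "\<dots> \<le> L2_norm T (\<lambda>t. p t - us t) + ?b"
      by (intro L2_norm_triangle L2_closed L2)
    finally show ?thesis using near by simp
  qed
  moreover have "L2_norm T y \<le> C * s" using near unfolding y_def L2_norm_diff_commute[of T us p] by simp
  moreover have "L2_norm T z \<le> s" using err unfolding z_def L2_norm_diff_commute[of T d dv] .
  moreover have "L2_norm T x \<le> \<kappa> * ?a" using contr unfolding x_def .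
  ultimately have "L2_norm T e * L2_norm T y \<le> ?b * (C * s)"
    "L2_norm T x * L2_norm T r \<le> (\<kappa> * ?a) * (C * s + ?b)"
    "L2_norm T z * L2_norm T r \<le> s * (C * s + ?b)"
    using \<kappa> pos unfolding e_def by (intro mult_mono; simp add: L2_norm_nonneg)+
  hence 1: "L2_inner T e y \<le> ?b * (C * s)" and 2: "L2_inner T x r \<le> (\<kappa> * ?a) * (C * s + ?b)"
    and "L2_inner T z r \<le> s * (C * s + ?b)"
    using L2_cauchy_schwarz mem by (smt (verit))+
  hence 3: "\<rho> * L2_inner T z r \<le> \<rho> * (s * (C * s + ?b))" using pos by (intro mult_left_mono) auto
  have 4: "\<rho> * L2_inner T ds (\<lambda>t. p t - us t) \<le> \<rho> * (C * s\<^sup>2)"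
    using pos near by (intro mult_left_mono) auto
  have 5: "0 \<le> \<rho> * L2_inner T ds (\<lambda>t. w t - us t)" using pos vi by simp
  have "?b\<^sup>2 = L2_inner T e e" by (simp add: L2_norm_squared e_def)
  also have "\<dots> \<le> ?b * (C * s) + (\<kappa> * ?a) * (C * s + ?b) + \<rho> * (s * (C * s + ?b)) + \<rho> * (C * s\<^sup>2)"
    using split 1 2 3 4 5 proj unfolding r_def by linarith
  finally show "?b\<^sup>2 \<le> ?b * (C * s) + (\<kappa> * ?a + \<rho> * s) * (C * s + ?b) + \<rho> * (C * s\<^sup>2)"
    by (simp add: algebra_simps)
qed (use pos \<kappa> in \<open>simp_all add: L2_norm_nonneg\<close>)

lemma limsup_affine_recursion:
  fixes x :: "nat \<Rightarrow> real"
  assumes \<theta>: "0 \<le> \<theta>" "\<theta> < 1" and c: "0 \<le> c" "0 \<le> s" and x: "\<And>i. 0 \<le> x i"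
    and rec: "\<And>i. (x (Suc i))\<^sup>2 \<le> \<theta> * (x i)\<^sup>2 + c * s\<^sup>2"
  shows "limsup (\<lambda>i. ereal (x (Suc i))) \<le> ereal (sqrt (c / (1 - \<theta>)) * s)"
proof -
  define l where "l = c * s\<^sup>2 / (1 - \<theta>)"
  have l: "\<theta> * l + c * s\<^sup>2 = l" using \<theta> by (simp add: l_def field_simps)
  have l0: "0 \<le> l" using \<theta> c by (simp add: l_def)
  have sq: "(x i)\<^sup>2 \<le> \<theta> ^ i * (x 0)\<^sup>2 + l" for i
  proof (induction i)
    case (Suc i)
    have "(x (Suc i))\<^sup>2 \<le> \<theta> * (\<theta> ^ i * (x 0)\<^sup>2 + l) + c * s\<^sup>2"
      using rec[of i] mult_left_mono[OF Suc \<theta>(1)] by linarith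
    also have "\<dots> = \<theta> ^ Suc i * (x 0)\<^sup>2 + l" using l by (simp add: algebra_simps)
    finally show ?case .
  qed (use l0 in simp)
  have "(\<lambda>i. sqrt (\<theta> ^ Suc i * (x 0)\<^sup>2 + l)) \<longlonglongrightarrow> sqrt (0 * (x 0)\<^sup>2 + l)"
    using \<theta> by (intro tendsto_intros LIMSEQ_Suc LIMSEQ_power_zero) auto
  hence lim: "(\<lambda>i. ereal (sqrt (\<theta> ^ Suc i * (x 0)\<^sup>2 + l))) \<longlonglongrightarrow> ereal (sqrt l)"
    by simp
  have "limsup (\<lambda>i. ereal (x (Suc i))) \<le> limsup (\<lambda>i. ereal (sqrt (\<theta> ^ Suc i * (x 0)\<^sup>2 + l)))"
  proof (intro Limsup_mono always_eventually allI)
    fix i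
    have "x (Suc i) \<le> sqrt (\<theta> ^ Suc i * (x 0)\<^sup>2 + l)" using sq[of "Suc i"] by (rule real_le_rsqrt)
    thus "ereal (x (Suc i)) \<le> ereal (sqrt (\<theta> ^ Suc i * (x 0)\<^sup>2 + l))" by simp
  qed
  also have "\<dots> = ereal (sqrt l)" using lim by (intro lim_imp_Limsup) auto
  also have "sqrt l = sqrt (c / (1 - \<theta>)) * s"
    using c by (simp add: l_def real_sqrt_mult real_sqrt_divide)
  finally show ?thesis by simp
qed

text \<open>The iteration for an arbitrary sequence of inexact gradients \<open>d i\<close>, under an affine constraint
  whose normal \<open>\<phi>\<close> is Lipschitz with nonzero integral. The constant is chosen before the number of
  cells, the iterates and the gradients.\<close>

lemma projected_gradient_limsup:
  assumes T: "0 < T" and affine: "\<And>v w. v \<in> L2 T \<Longrightarrow> w \<in> L2 T \<Longrightarrow> G v - G w = L2_inner T \<phi> (\<lambda>t. v t - w t)"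
    and \<phi>: "A-lipschitz_on {0..T} \<phi>" "(\<integral>t. \<phi> t \<partial>time_measure T) \<noteq> 0"
    and grad: "has_L2_gradient T J dJ"
    and us: "us \<in> L2 T" "G us \<le> \<delta>" and min: "\<And>v. v \<in> L2 T \<Longrightarrow> G v \<le> \<delta> \<Longrightarrow> J us \<le> J v"
    and lip: "L2_lipschitz T us" "L2_lipschitz T (dJ us)"
    and C1: "\<And>v w. v \<in> L2 T \<Longrightarrow> w \<in> L2 T \<Longrightarrow>
      L2_norm T (\<lambda>t. dJ v t - dJ w t) \<le> C\<^sub>1 * L2_norm T (\<lambda>t. v t - w t)"
    and C2: "\<And>v w. v \<in> L2 T \<Longrightarrow> w \<in> L2 T \<Longrightarrow>
      C\<^sub>2 * (L2_norm T (\<lambda>t. v t - w t))\<^sup>2 \<le> L2_inner T (\<lambda>t. dJ v t - dJ w t) (\<lambda>t. v t - w t)"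
    and \<rho>: "0 < \<rho>" "0 < 1 - 2 * C\<^sub>2 * \<rho> + (1 + 2 * C\<^sub>1\<^sup>2) * \<rho>\<^sup>2"
      "1 - 2 * C\<^sub>2 * \<rho> + (1 + 2 * C\<^sub>1\<^sup>2) * \<rho>\<^sup>2 < 1"
  obtains C where "0 < C"
    "\<And>N u d. \<lbrakk>0 < N; u 0 \<in> L2 T; \<And>i. d i \<in> L2 T;
      \<And>i::nat. is_L2_projection T (step_controls T N \<inter> {v \<in> L2 T. G v \<le> \<delta>})
        (\<lambda>t. u i t - \<rho> * d i t) (u (Suc i))\<rbrakk> \<Longrightarrow>
      limsup (\<lambda>i. ereal (L2_norm T (\<lambda>t. us t - u (Suc i) t))) \<le>
        ereal C * (ereal (T / real N) + (SUP i. ereal (L2_norm T (\<lambda>t. dJ (u i) t - d i t))))"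
proof -
  have dJ: "dJ v \<in> L2 T" if "v \<in> L2 T" for v
    using grad that by (simp add: has_L2_gradient_def)
  have \<phi>L2: "\<phi> \<in> L2 T" using \<phi>(1) by (rule L2_lipschitz_on)
  have vi: "0 \<le> L2_inner T (dJ us) (\<lambda>t. v t - us t)" if v: "v \<in> L2 T" "G v \<le> \<delta>" for v
  proof (rule minimizer_variational_inequality[OF grad us(1) v(1)])
    fix s :: real assume s: "0 < s" "s \<le> 1"
    let ?v = "\<lambda>t. us t + s * (v t - us t)"
    have mem: "?v \<in> L2 T" by (intro L2_closed us v)
    \<comment> \<open>An affine \<open>G\<close> makes the admissible set convex.\<close>
    have "G ?v - G us = s * (G v - G us)"
      using affine[OF mem us(1)] affine[OF v(1) us(1)] by (simp add: L2_inner_cmult_right)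
    hence "G ?v = (1 - s) * G us + s * G v" by (simp add: algebra_simps)
    also have "\<dots> \<le> (1 - s) * \<delta> + s * \<delta>"
      using s us v by (intro add_mono mult_left_mono) auto
    finally have "G ?v \<le> \<delta>" by (simp add: algebra_simps)
    thus "J us \<le> J ?v" by (intro min mem)
  qed
  obtain K where K: "0 \<le> K" and approx: "\<And>N. 0 < N \<Longrightarrow> \<exists>p\<in>step_controls T N. G p \<le> G us \<and>
      L2_norm T (\<lambda>t. p t - us t) \<le> K * (T / real N) \<and>
      L2_inner T (dJ us) (\<lambda>t. p t - us t) \<le> K * (T / real N)\<^sup>2"
    using feasible_step_approximation[OF T affine \<phi> us(1) lip(1) dJ[OF us(1)] lip(2)] by blast
  define \<kappa> where "\<kappa> = sqrt (1 - 2 * C\<^sub>2 * \<rho> + (1 + 2 * C\<^sub>1\<^sup>2) * \<rho>\<^sup>2)"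
  have \<kappa>: "0 \<le> \<kappa>" "\<kappa> < 1" "1 - 2 * C\<^sub>2 * \<rho> + (1 + 2 * C\<^sub>1\<^sup>2) * \<rho>\<^sup>2 = \<kappa>\<^sup>2"
    using \<rho> by (simp_all add: \<kappa>_def)
  define \<theta> where "\<theta> = (1 + \<kappa>) / (3 - \<kappa>)"
  define c where "c = 4 / (3 - \<kappa>) * (2 * (K + \<rho>)\<^sup>2 / (1 - \<kappa>) + 2 * \<rho> * K)"
  have \<theta>: "0 \<le> \<theta>" "\<theta> < 1" using \<kappa> by (auto simp: \<theta>_def)
  have "0 < c"
    unfolding c_def using \<kappa> \<rho> K
    by (intro mult_pos_pos add_pos_nonneg divide_pos_pos) auto
  hence c: "0 \<le> c" by simp
  define C where "C = sqrt (c / (1 - \<theta>))"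
  have C: "0 < C" using \<open>0 < c\<close> \<theta> by (simp add: C_def)
  show ?thesis
  proof (rule that[OF C])
    fix N :: nat and u d
    assume N: "0 < N" and u0: "u 0 \<in> L2 T" and d: "\<And>i. d i \<in> L2 T"
      and proj: "\<And>i. is_L2_projection T (step_controls T N \<inter> {v \<in> L2 T. G v \<le> \<delta>})
        (\<lambda>t. u i t - \<rho> * d i t) (u (Suc i))"
    have feasible: "u (Suc i) \<in> L2 T" "G (u (Suc i)) \<le> \<delta>" for i
      using proj by (auto simp: is_L2_projection_def)
    have u: "u i \<in> L2 T" for i using u0 feasible by (cases i) auto
    define \<epsilon> where "\<epsilon> = (SUP i. ereal (L2_norm T (\<lambda>t. dJ (u i) t - d i t)))"
    have \<epsilon>: "ereal (L2_norm T (\<lambda>t. dJ (u i) t - d i t)) \<le> \<epsilon>" for i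
      unfolding \<epsilon>_def by (rule SUP_upper) simp
    have "ereal 0 \<le> ereal (L2_norm T (\<lambda>t. dJ (u 0) t - d 0 t))" by (simp add: L2_norm_nonneg)
    hence \<epsilon>0: "ereal 0 \<le> \<epsilon>" using \<epsilon>[of 0] by (rule order_trans)
    have "limsup (\<lambda>i. ereal (L2_norm T (\<lambda>t. us t - u (Suc i) t))) \<le> ereal C * (ereal (T / real N) + \<epsilon>)"
    proof (cases \<epsilon>)
      case (real e)
      define s where "s = T / real N + e"
      have dt: "0 < T / real N" using T N by simp
      have e: "0 \<le> e" "L2_norm T (\<lambda>t. dJ (u i) t - d i t) \<le> e" for i
        using \<epsilon>0 \<epsilon>[of i] real by auto
      have s: "0 \<le> s" "T / real N \<le> s" "e \<le> s" using dt e(1) by (auto simp: s_def)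
      obtain p where p: "p \<in> step_controls T N" "G p \<le> G us"
          "L2_norm T (\<lambda>t. p t - us t) \<le> K * (T / real N)"
          "L2_inner T (dJ us) (\<lambda>t. p t - us t) \<le> K * (T / real N)\<^sup>2"
        using approx[OF N] by blast
      have pL2: "p \<in> L2 T" using p(1) by (simp add: step_controls_def)
      have near: "L2_norm T (\<lambda>t. p t - us t) \<le> K * s" "L2_inner T (dJ us) (\<lambda>t. p t - us t) \<le> K * s\<^sup>2"
        using p(3,4) mult_left_mono[OF s(2) K] mult_left_mono[OF power_mono[OF s(2), of 2] K] dt by auto
      have rec: "(L2_norm T (\<lambda>t. us t - u (Suc i) t))\<^sup>2 \<le>
          \<theta> * (L2_norm T (\<lambda>t. us t - u i t))\<^sup>2 + c * s\<^sup>2" for i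
        unfolding \<theta>_def c_def
      proof (rule projected_gradient_error[OF us(1) u u pL2 dJ[OF us(1)] dJ[OF u] _ \<rho>(1) s(1) K \<kappa>(1,2) _ _ _ _ near])
        show "d i \<in> L2 T" using d by simp
        show "0 \<le> L2_inner T (\<lambda>t. u (Suc i) t - (u i t - \<rho> * d i t)) (\<lambda>t. p t - u (Suc i) t)"
          using proj p(1,2) pL2 us(2) by (auto simp: is_L2_projection_def)
        show "0 \<le> L2_inner T (dJ us) (\<lambda>t. u (Suc i) t - us t)" by (intro vi feasible)
        show "L2_norm T (\<lambda>t. (us t - u i t) - \<rho> * (dJ us t - dJ (u i) t)) \<le>
            \<kappa> * L2_norm T (\<lambda>t. us t - u i t)"
          by (rule gradient_step_contracts[OF us(1) u dJ[OF us(1)] dJ[OF u] \<rho>(1)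
            C1[OF us(1) u] C2[OF us(1) u] \<kappa>(1,3)])
        show "L2_norm T (\<lambda>t. dJ (u i) t - d i t) \<le> s" using e(2)[of i] s(3) by linarith
      qed
      have "limsup (\<lambda>i. ereal (L2_norm T (\<lambda>t. us t - u (Suc i) t))) \<le> ereal (sqrt (c / (1 - \<theta>)) * s)"
        by (rule limsup_affine_recursion[where x = "\<lambda>i. L2_norm T (\<lambda>t. us t - u i t)", OF \<theta> c s(1) L2_norm_nonneg rec])
      also have "\<dots> = ereal C * (ereal (T / real N) + \<epsilon>)" by (simp add: s_def C_def real)
      finally show ?thesis .
    next
      case PInf
      thus ?thesis using C by simp
    next
      case MInf
      thus ?thesis using \<epsilon>0 by simp
    qed
    thus "limsup (\<lambda>i. ereal (L2_norm T (\<lambda>t. us t - u (Suc i) t))) \<le>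
      ereal C * (ereal (T / real N) + (SUP i. ereal (L2_norm T (\<lambda>t. dJ (u i) t - d i t))))"
      unfolding \<epsilon>_def .
  qed
qed

section \<open>Ito integrals have mean zero\<close>

lemma natural_filtration_subalgebra:
  assumes W: "\<And>s. s \<in> {0..t} \<Longrightarrow> W s \<in> borel_measurable M"
  shows "space (natural_filtration M W t) = space M" "sets (natural_filtration M W t) \<subseteq> sets M"
proof -
  let ?G = "{W s -` B \<inter> space M | s B. 0 \<le> s \<and> s \<le> t \<and> B \<in> sets borel} \<union> null_sets M"
  have G: "?G \<subseteq> sets M" using W by (auto intro: measurable_sets)
  hence "?G \<subseteq> Pow (space M)" using sets.space_closed[of M] by blast
  thus "space (natural_filtration M W t) = space M" "sets (natural_filtration M W t) \<subseteq> sets M"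
    unfolding natural_filtration_def using sets.sigma_sets_subset[OF G]
    by (simp_all add: space_measure_of_conv sets_measure_of_conv)
qed

text \<open>The increment is centred and independent of \<open>\<phi>\<close>, which is measurable with respect to its past.\<close>

lemma brownian_increment_orthogonal:
  assumes "prob_space M" and bm: "brownian_motion M (natural_filtration M W) T W"
    and st: "0 \<le> s" "s \<le> t" "t \<le> T"
    and \<phi>: "\<phi> \<in> borel_measurable (natural_filtration M W s)"
    and B: "\<And>\<omega>. \<omega> \<in> space (natural_filtration M W s) \<Longrightarrow> \<bar>\<phi> \<omega>\<bar> \<le> B"
  shows "integrable M (\<lambda>\<omega>. \<phi> \<omega> * (W t \<omega> - W s \<omega>))"
    and "(\<integral>\<omega>. \<phi> \<omega> * (W t \<omega> - W s \<omega>) \<partial>M) = 0"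
proof -
  interpret prob_space M by fact
  let ?F = "natural_filtration M W s" and ?X = "\<lambda>\<omega>. W t \<omega> - W s \<omega>"
  have "integrable M (\<lambda>\<omega>. \<phi> \<omega> * ?X \<omega>) \<and> (\<integral>\<omega>. \<phi> \<omega> * ?X \<omega> \<partial>M) = 0"
  \<comment> \<open>A partition may contain empty intervals, on which the increment vanishes.\<close>
  proof (cases "s = t")
    case False
    hence lt: "s < t" using st by simp
    have W: "W r \<in> borel_measurable M" if "r \<in> {0..T}" for r
      using bm that by (simp add: brownian_motion_def)
    have F: "space ?F = space M" "sets ?F \<subseteq> sets M"
      using natural_filtration_subalgebra[of s W M] W st by auto
    have X: "?X \<in> borel_measurable M" using W st by (intro borel_measurable_diff) auto
    have dist: "distributed M lborel ?X (normal_density 0 (sqrt (t - s)))"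
      and ind: "indep_set (sets ?F) (sets (vimage_algebra (space M) ?X borel))"
      using bm lt st by (auto simp: brownian_motion_def)
    have sd: "0 < sqrt (t - s)" using lt by simp
    have Xint: "integrable M ?X"
    proof -
      have "integrable lborel (\<lambda>x. normal_density 0 (sqrt (t - s)) x * x)"
        using integrable_normal_moment[OF sd, of 0 1] by (simp only: diff_zero power_one_right)
      thus ?thesis using distributed_integrable[OF dist, of "\<lambda>x. x"] by simp
    qed
    have Xmean: "expectation ?X = 0" by (rule normal_distributed_expectation[OF sd dist])
    have \<phi>M: "\<phi> \<in> borel_measurable M"
      using \<phi> F by (auto simp: measurable_def)
    have \<phi>int: "integrable M \<phi>"
      using B F by (intro integrable_const_bound[where B = B] \<phi>M) auto
    have "indep_set (sigma_sets (space M) {\<phi> -` A \<inter> space M | A. A \<in> sets borel})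
        (sigma_sets (space M) {?X -` A \<inter> space M | A. A \<in> sets borel})"
      unfolding indep_set_def
    proof (rule indep_sets_mono_sets[OF ind[unfolded indep_set_def]])
      fix b :: bool assume "b \<in> UNIV"
      have "sigma_sets (space M) {\<phi> -` A \<inter> space M | A. A \<in> sets borel} \<subseteq> sets ?F"
        using measurable_sets[OF \<phi>] F(1) sets.sigma_sets_subset[of "{\<phi> -` A \<inter> space M | A. A \<in> sets borel}" ?F]
        by auto
      moreover have "sigma_sets (space M) {?X -` A \<inter> space M | A. A \<in> sets borel} =
          sets (vimage_algebra (space M) ?X borel)"
        unfolding vimage_algebra_def by (subst sets_measure_of) auto
      ultimately show "case_bool (sigma_sets (space M) {\<phi> -` A \<inter> space M | A. A \<in> sets borel})
          (sigma_sets (space M) {?X -` A \<inter> space M | A. A \<in> sets borel}) b \<subseteq>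
          case_bool (sets ?F) (sets (vimage_algebra (space M) ?X borel)) b"
        by (simp split: bool.split)
    qed
    hence indep: "indep_var borel \<phi> borel ?X" unfolding indep_var_eq using \<phi>M X by simp
    show ?thesis
      using indep_var_integrable[OF indep \<phi>int Xint] indep_var_lebesgue_integral[OF indep \<phi>int Xint] Xmean
      by simp
  qed simp
  thus "integrable M (\<lambda>\<omega>. \<phi> \<omega> * ?X \<omega>)" "(\<integral>\<omega>. \<phi> \<omega> * ?X \<omega> \<partial>M) = 0" by auto
qed

lemma simple_ito_mean_zero:
  assumes "prob_space M" and bm: "brownian_motion M (natural_filtration M W) T W" and "t \<le> T"
    and simple: "simple_process (natural_filtration M W) t n \<tau> \<phi>"
  shows "integrable M (simple_ito W n \<tau> \<phi>)" "(\<integral>\<omega>. simple_ito W n \<tau> \<phi> \<omega> \<partial>M) = 0"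
proof -
  have mono: "\<tau> i \<le> \<tau> j" if "i \<le> j" "j \<le> n" for i j
    using simple that by (auto simp: simple_process_def mono_on_def)
  have term_i: "integrable M (\<lambda>\<omega>. \<phi> i \<omega> * (W (\<tau> (Suc i)) \<omega> - W (\<tau> i) \<omega>)) \<and>
      (\<integral>\<omega>. \<phi> i \<omega> * (W (\<tau> (Suc i)) \<omega> - W (\<tau> i) \<omega>) \<partial>M) = 0" if i: "i < n" for i
  proof -
    from simple i obtain B where \<phi>: "\<phi> i \<in> borel_measurable (natural_filtration M W (\<tau> i))"
      and B: "\<forall>\<omega>\<in>space (natural_filtration M W (\<tau> i)). \<bar>\<phi> i \<omega>\<bar> \<le> B"
      by (auto simp: simple_process_def)
    have "0 \<le> \<tau> i" "\<tau> i \<le> \<tau> (Suc i)" "\<tau> (Suc i) \<le> T"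
      using mono[of 0 i] mono[of i "Suc i"] mono[of "Suc i" n] simple i \<open>t \<le> T\<close>
      by (auto simp: simple_process_def)
    thus ?thesis using brownian_increment_orthogonal[OF assms(1,2) _ _ _ \<phi>] B by blast
  qed
  show "integrable M (simple_ito W n \<tau> \<phi>)"
    unfolding simple_ito_def[abs_def] using term_i by (intro Bochner_Integration.integrable_sum) auto
  have "(\<integral>\<omega>. simple_ito W n \<tau> \<phi> \<omega> \<partial>M) =
      (\<Sum>i<n. \<integral>\<omega>. \<phi> i \<omega> * (W (\<tau> (Suc i)) \<omega> - W (\<tau> i) \<omega>) \<partial>M)"
    unfolding simple_ito_def using term_i by (intro Bochner_Integration.integral_sum) auto
  thus "(\<integral>\<omega>. simple_ito W n \<tau> \<phi> \<omega> \<partial>M) = 0" using term_i by simp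
qed

text \<open>The approximating simple integrals have mean zero, and convergence in \<open>L\<^sup>2(P)\<close> implies
  convergence of the means.\<close>

lemma ito_integral_mean_zero:
  assumes "prob_space M" and bm: "brownian_motion M (natural_filtration M W) T W" and "t \<le> T"
    and ito: "has_ito_integral M (natural_filtration M W) W t X I"
  shows "integrable M I" "(\<integral>\<omega>. I \<omega> \<partial>M) = 0"
proof -
  interpret prob_space M by fact
  from ito have I: "I \<in> borel_measurable M" by (simp add: has_ito_integral_def)
  from ito obtain n \<tau> \<phi> where simple: "\<And>k::nat. simple_process (natural_filtration M W) t (n k) (\<tau> k) (\<phi> k)"
    and lim: "(\<lambda>k. \<integral>\<^sup>+\<omega>. ennreal ((I \<omega> - simple_ito W (n k) (\<tau> k) (\<phi> k) \<omega>)\<^sup>2) \<partial>M) \<longlonglongrightarrow> 0"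
    unfolding has_ito_integral_def by blast
  have close: "integrable M I \<and> (expectation I)\<^sup>2 < e" if e: "0 < e" for e :: real
  proof -
    have "\<forall>\<^sub>F k in sequentially.
        (\<integral>\<^sup>+\<omega>. ennreal ((I \<omega> - simple_ito W (n k) (\<tau> k) (\<phi> k) \<omega>)\<^sup>2) \<partial>M) < ennreal e"
      using lim e by (intro order_tendstoD) auto
    then obtain k where k: "(\<integral>\<^sup>+\<omega>. ennreal ((I \<omega> - simple_ito W (n k) (\<tau> k) (\<phi> k) \<omega>)\<^sup>2) \<partial>M) < ennreal e"
      by (auto dest: eventually_happens)
    define S where "S = simple_ito W (n k) (\<tau> k) (\<phi> k)"
    have S: "integrable M S" "expectation S = 0"
      unfolding S_def by (rule simple_ito_mean_zero[OF assms(1-3) simple])+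
    have meas: "(\<lambda>\<omega>. I \<omega> - S \<omega>) \<in> borel_measurable M" using I S(1) by auto
    have sq: "integrable M (\<lambda>\<omega>. (I \<omega> - S \<omega>)\<^sup>2)"
      using meas k unfolding S_def[symmetric]
      by (intro integrableI_bounded) (auto simp: top.not_eq_extremum intro: less_trans)
    have diff: "integrable M (\<lambda>\<omega>. I \<omega> - S \<omega>)"
      using square_integrable_imp_integrable[OF meas sq] .
    have "ennreal (expectation (\<lambda>\<omega>. (I \<omega> - S \<omega>)\<^sup>2)) < ennreal e"
      using k nn_integral_eq_integral[OF sq] unfolding S_def[symmetric] by simp
    hence small: "expectation (\<lambda>\<omega>. (I \<omega> - S \<omega>)\<^sup>2) < e"
      by (simp add: ennreal_less_iff)
    have Iint: "integrable M I" using Bochner_Integration.integrable_add[OF diff S(1)] by simp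
    have "expectation I = expectation (\<lambda>\<omega>. (I \<omega> - S \<omega>) * 1)" using Iint S by simp
    hence "(expectation I)\<^sup>2 \<le> expectation (\<lambda>\<omega>. (I \<omega> - S \<omega>)\<^sup>2)"
      using integral_mult_le_squares[OF meas _ sq, of "\<lambda>_. 1"] prob_space by simp
    thus ?thesis using small Iint by simp
  qed
  show "integrable M I" using close[of 1] by simp
  show "expectation I = 0"
  proof (rule ccontr)
    assume "expectation I \<noteq> 0"
    thus False using close[of "(expectation I)\<^sup>2"] by simp
  qed
qed

section \<open>Linear Volterra equations and their adjoint\<close>

text \<open>Variation of constants: \<open>\<psi> t\<close> is the integral over \<open>[t,T]\<close> of \<open>e s / e t\<close>, where
  \<open>e\<close> is the exponential of the antiderivative of \<open>b\<close>. Positivity is visible from this formula.\<close>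

lemma adjoint_solution:
  assumes T: "0 < T" and b: "continuous_on {0..T} b"
  obtains \<psi> :: "real \<Rightarrow> real" where
    "\<And>t. t \<in> {0..T} \<Longrightarrow> (\<psi> has_real_derivative - (b t * \<psi> t + 1)) (at t within {0..T})"
    "\<psi> T = 0" "\<And>t. t \<in> {0..<T} \<Longrightarrow> 0 < \<psi> t"
proof -
  define e where "e = (\<lambda>t. exp (integral {0..t} b))"
  have e: "(e has_real_derivative e t * b t) (at t within {0..T})" if "t \<in> {0..T}" for t
    unfolding e_def by (rule DERIV_chain2[OF DERIV_exp integral_has_real_derivative[OF b that]])
  have e_pos: "0 < e t" for t by (simp add: e_def)
  have e_cont: "continuous_on {0..T} e"
    by (rule DERIV_continuous_on) (rule e)
  define r where "r = (\<lambda>t. integral {t..T} e)"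
  have r: "(r has_real_derivative - e t) (at t within {0..T})" if "t \<in> {0..T}" for t
    unfolding r_def by (rule integral_has_real_derivative'[OF e_cont that])
  show ?thesis
  proof (rule that[of "\<lambda>t. r t / e t"])
    fix t assume t: "t \<in> {0..T}"
    show "((\<lambda>t. r t / e t) has_real_derivative - (b t * (r t / e t) + 1)) (at t within {0..T})"
      using e_pos[of t] by (auto intro!: derivative_eq_intros r[OF t] e[OF t] simp: field_simps)
  next
    show "r T / e T = 0" by (simp add: r_def)
  next
    fix t assume t: "t \<in> {0..<T}"
    have ct: "continuous_on {t..T} e" using t by (intro continuous_on_subset[OF e_cont]) auto
    have "0 \<le> r t" unfolding r_def using e_pos by (intro integral_nonneg integrable_continuous_interval ct) (simp add: less_imp_le)
    moreover have "r t \<noteq> 0"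
    proof
      assume "r t = 0"
      hence "e t = 0" 
        using integral_eq_0_iff[OF ct, of] t e_pos unfolding r_def by (auto simp: less_imp_le)
      thus False using e_pos[of t] by simp
    qed
    ultimately show "0 < r t / e t" using e_pos[of t] by simp
  qed
qed

lemma integral_time_measure_FTC:
  assumes "0 \<le> s" "s \<le> T" and f: "continuous_on {0..T} f"
    and F: "\<And>t. t \<in> {0..T} \<Longrightarrow> (F has_real_derivative f t) (at t within {0..T})"
  shows "(\<integral>t. indicator {s..T} t * f t \<partial>time_measure T) = F T - F s"
proof -
  have "(\<integral>t. indicator {s..T} t * f t \<partial>time_measure T) =
      (\<integral>t. indicator {0..T} t *\<^sub>R (indicator {s..T} t * f t) \<partial>lborel)"
    by (intro integral_restrict_space) auto
  also have "\<dots> = (\<integral>t. indicator {s..T} t *\<^sub>R f t \<partial>lborel)"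
    using assms(1) by (intro Bochner_Integration.integral_cong) (auto simp: indicator_def)
  also have "\<dots> = F T - F s"
  proof (rule integral_FTC_atLeastAtMost)
    fix t assume "s \<le> t" "t \<le> T"
    thus "(F has_vector_derivative f t) (at t within {s..T})"
      using assms(1) F[of t] 
      by (auto simp: has_real_derivative_iff_has_vector_derivative[symmetric] intro: DERIV_subset)
  qed (use assms continuous_on_subset[OF f] in auto)
  finally show ?thesis .
qed

text \<open>Formally this is integration by parts of \<open>(D \<psi>)'\<close>. Since \<open>f\<close>, and with it the integrand \<open>g\<close> that
  defines \<open>D\<close>, is merely integrable, \<open>D\<close> need not be differentiable; exchanging the order of
  integration in the double integral of \<open>g s * h t\<close> over \<open>s \<le> t\<close>, with \<open>h = - \<psi>'\<close>, does the same.\<close>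

lemma volterra_duality:
  assumes T: "0 < T" and b: "continuous_on {0..T} b"
    and \<psi>: "\<And>t. t \<in> {0..T} \<Longrightarrow> (\<psi> has_real_derivative - (b t * \<psi> t + 1)) (at t within {0..T})" "\<psi> T = 0"
    and D: "integrable (time_measure T) D" and f: "integrable (time_measure T) f"
    and eq: "\<And>t. t \<in> {0..T} \<Longrightarrow> D t = (\<integral>s. indicator {0..t} s * (b s * D s + f s) \<partial>time_measure T)"
  shows "(\<integral>t. D t \<partial>time_measure T) = (\<integral>t. \<psi> t * f t \<partial>time_measure T)"
proof -
  let ?\<mu> = "time_measure T"
  interpret finite_measure ?\<mu> by (rule finite_measure_time_measure)
  interpret P: pair_sigma_finite ?\<mu> ?\<mu> ..
  have \<psi>_cont: "continuous_on {0..T} \<psi>" by (rule DERIV_continuous_on) (rule \<psi>(1))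
  have bounded_mult: "integrable ?\<mu> (\<lambda>t. c t * h t)"
    if c: "continuous_on {0..T} c" and h: "integrable ?\<mu> h" for c h :: "real \<Rightarrow> real"
  proof -
    obtain K where K: "\<And>t. t \<in> {0..T} \<Longrightarrow> \<bar>c t\<bar> \<le> K"
      using continuous_on_Icc_bounded[OF c] by blast
    show ?thesis
    proof (rule Bochner_Integration.integrable_bound[where f = "\<lambda>t. K * h t"])
      show "(\<lambda>t. c t * h t) \<in> borel_measurable ?\<mu>"
        using measurable_time_measure_continuous[OF c] h by auto
      show "AE t in ?\<mu>. norm (c t * h t) \<le> norm (K * h t)"
        using K by (intro AE_I2) (fastforce simp: abs_mult intro!: mult_right_mono intro: order_trans)
    qed (use h in simp)
  qed
  define g where "g = (\<lambda>s. b s * D s + f s)"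
  define h where "h = (\<lambda>t. b t * \<psi> t + 1)"
  have g: "integrable ?\<mu> g" unfolding g_def using bounded_mult[OF b D] f by simp
  have h_cont: "continuous_on {0..T} h" unfolding h_def using b \<psi>_cont by (intro continuous_intros)
  have h: "h \<in> borel_measurable ?\<mu>" by (rule measurable_time_measure_continuous[OF h_cont])
  have h_int: "integrable ?\<mu> h" using bounded_mult[OF h_cont, of "\<lambda>_. 1"] by simp
  have prod: "integrable (?\<mu> \<Otimes>\<^sub>M ?\<mu>) (\<lambda>(t, s). indicator {0..t} s * (g s * h t))"
  proof (rule Bochner_Integration.integrable_bound[where f = "\<lambda>(t, s). h t * g s"])
    show "integrable (?\<mu> \<Otimes>\<^sub>M ?\<mu>) (\<lambda>(t, s). h t * g s)"
    proof (rule P.Fubini_integrable)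
      show "(\<lambda>(t, s). h t * g s) \<in> borel_measurable (?\<mu> \<Otimes>\<^sub>M ?\<mu>)" using h g by measurable
      show "integrable ?\<mu> (\<lambda>x. \<integral>y. norm (case (x, y) of (t, s) \<Rightarrow> h t * g s) \<partial>?\<mu>)"
        using h_int g by (simp add: abs_mult)
      show "AE x in ?\<mu>. integrable ?\<mu> (\<lambda>y. case (x, y) of (t, s) \<Rightarrow> h t * g s)"
        using g by simp
    qed
    have "(\<lambda>x. indicator {x. 0 \<le> snd x \<and> snd x \<le> fst x} x * (g (snd x) * h (fst x)) :: real)
        \<in> borel_measurable (?\<mu> \<Otimes>\<^sub>M ?\<mu>)"
    proof (intro borel_measurable_times borel_measurable_indicator')
      have id: "(\<lambda>x. x) \<in> borel_measurable ?\<mu>" by (rule measurable_time_measure_continuous) (rule continuous_on_id)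
      have [measurable]: "fst \<in> borel_measurable (?\<mu> \<Otimes>\<^sub>M ?\<mu>)"
        by (rule measurable_compose[OF measurable_fst id])
      have [measurable]: "snd \<in> borel_measurable (?\<mu> \<Otimes>\<^sub>M ?\<mu>)"
        by (rule measurable_compose[OF measurable_snd id])
      show "{x \<in> space (?\<mu> \<Otimes>\<^sub>M ?\<mu>). x \<in> {x. 0 \<le> snd x \<and> snd x \<le> fst x}} \<in> sets (?\<mu> \<Otimes>\<^sub>M ?\<mu>)"
        by simp
      show "(\<lambda>x. g (snd x)) \<in> borel_measurable (?\<mu> \<Otimes>\<^sub>M ?\<mu>)" using g by measurable
      show "(\<lambda>x. h (fst x)) \<in> borel_measurable (?\<mu> \<Otimes>\<^sub>M ?\<mu>)" using h by measurable
    qed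
    moreover have "(\<lambda>(t, s). indicator {0..t} s * (g s * h t)) =
        (\<lambda>x. indicator {x. 0 \<le> snd x \<and> snd x \<le> fst x} x * (g (snd x) * h (fst x)) :: real)"
      by (auto simp: indicator_def)
    ultimately show "(\<lambda>(t, s). indicator {0..t} s * (g s * h t)) \<in> borel_measurable (?\<mu> \<Otimes>\<^sub>M ?\<mu>)"
      by simp
  qed (auto simp: indicator_def abs_mult)
  have "(\<integral>t. h t * D t \<partial>?\<mu>) = (\<integral>t. (\<integral>s. indicator {0..t} s * (g s * h t) \<partial>?\<mu>) \<partial>?\<mu>)"
  proof (rule Bochner_Integration.integral_cong[OF refl])
    fix t assume "t \<in> space ?\<mu>"
    hence "D t = (\<integral>s. indicator {0..t} s * g s \<partial>?\<mu>)" using eq by (simp add: g_def)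
    thus "h t * D t = (\<integral>s. indicator {0..t} s * (g s * h t) \<partial>?\<mu>)"
      by (simp only: mult.assoc[symmetric] integral_mult_left_zero) (simp add: mult.commute)
  qed
  also have "\<dots> = (\<integral>s. (\<integral>t. indicator {0..t} s * (g s * h t) \<partial>?\<mu>) \<partial>?\<mu>)"
    using P.Fubini_integral[OF prod] by simp
  also have "\<dots> = (\<integral>s. g s * \<psi> s \<partial>?\<mu>)"
  proof (rule Bochner_Integration.integral_cong[OF refl])
    fix s assume s: "s \<in> space ?\<mu>"
    have "(\<integral>t. indicator {0..t} s * (g s * h t) \<partial>?\<mu>) = (\<integral>t. g s * (indicator {s..T} t * h t) \<partial>?\<mu>)"
      using s by (intro Bochner_Integration.integral_cong) (auto simp: indicator_def)
    also have "\<dots> = g s * (\<integral>t. indicator {s..T} t * h t \<partial>?\<mu>)" by simp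
    also have "(\<integral>t. indicator {s..T} t * h t \<partial>?\<mu>) = - \<psi> T - - \<psi> s"
      using s DERIV_minus[OF \<psi>(1)]
      by (intro integral_time_measure_FTC[where F = "\<lambda>t. - \<psi> t"] h_cont) (auto simp: h_def add.commute)
    finally show "(\<integral>t. indicator {0..t} s * (g s * h t) \<partial>?\<mu>) = g s * \<psi> s" using \<psi>(2) by simp
  qed
  finally have key: "(\<integral>t. h t * D t \<partial>?\<mu>) = (\<integral>s. g s * \<psi> s \<partial>?\<mu>)" .
  have i1: "integrable ?\<mu> (\<lambda>t. (b t * \<psi> t) * D t)"
    using b \<psi>_cont D by (intro bounded_mult continuous_intros)
  have i2: "integrable ?\<mu> (\<lambda>t. \<psi> t * f t)" by (intro bounded_mult \<psi>_cont f)
  have "(\<integral>t. h t * D t \<partial>?\<mu>) = (\<integral>t. (b t * \<psi> t) * D t \<partial>?\<mu>) + (\<integral>t. D t \<partial>?\<mu>)"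
    using i1 D by (simp add: h_def distrib_right)
  moreover have "(\<integral>s. g s * \<psi> s \<partial>?\<mu>) = (\<integral>s. (b s * \<psi> s) * D s + \<psi> s * f s \<partial>?\<mu>)"
    by (simp add: g_def algebra_simps)
  ultimately show ?thesis using key i1 i2 by simp
qed

section \<open>The mean state as an affine function of the control\<close>

text \<open>A progressive process is measurable for the smaller product \<open>\<sigma>\<close>-algebra built from the filtration
  at the final time, hence for the full one; the second moment and the finite measure give
  integrability.\<close>

lemma state_solution_integrable:
  assumes "prob_space M" and T: "0 < horizon P" and bm: "brownian_motion M (natural_filtration M W) (horizon P) W"
    and sol: "state_solution M (natural_filtration M W) W P u y"
  shows "integrable (time_measure (horizon P) \<Otimes>\<^sub>M M) (\<lambda>(t, \<omega>). y t \<omega>)"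
proof -
  let ?T = "horizon P" and ?F = "natural_filtration M W (horizon P)"
  let ?\<mu> = "time_measure ?T"
  interpret M: prob_space M by fact
  interpret \<mu>: finite_measure ?\<mu> by (rule finite_measure_time_measure)
  interpret prod: finite_measure "?\<mu> \<Otimes>\<^sub>M M"
    by (intro finite_measure_pair_measure) unfold_locales
  have "W s \<in> borel_measurable M" if "s \<in> {0..?T}" for s
    using bm that by (simp add: brownian_motion_def)
  hence sub: "space ?F = space M" "sets ?F \<subseteq> sets M"
    using natural_filtration_subalgebra[of ?T W M] by auto
  have id: "(\<lambda>\<omega>. \<omega>) \<in> measurable M ?F"
    using sub by (auto intro!: measurableI)
  have prog: "(\<lambda>(s, \<omega>). y s \<omega>) \<in> borel_measurable (?\<mu> \<Otimes>\<^sub>M ?F)"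
    using sol T by (simp add: state_solution_def progressive_def)
  have "(\<lambda>x. (fst x, snd x)) \<in> measurable (?\<mu> \<Otimes>\<^sub>M M) (?\<mu> \<Otimes>\<^sub>M ?F)"
    by (intro measurable_Pair measurable_fst measurable_compose[OF measurable_snd id])
  from measurable_compose[OF this prog]
  have meas: "(\<lambda>(t, \<omega>). y t \<omega>) \<in> borel_measurable (?\<mu> \<Otimes>\<^sub>M M)" by (simp add: case_prod_unfold)
  show ?thesis
  proof (rule prod.square_integrable_imp_integrable[OF meas])
    have "(\<integral>\<^sup>+x. ennreal ((case x of (t, \<omega>) \<Rightarrow> y t \<omega>)\<^sup>2) \<partial>(?\<mu> \<Otimes>\<^sub>M M)) =
        (\<integral>\<^sup>+t. (\<integral>\<^sup>+\<omega>. ennreal ((y t \<omega>)\<^sup>2) \<partial>M) \<partial>?\<mu>)"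
      using meas by (subst M.nn_integral_fst[symmetric]) auto
    also have "\<dots> < \<infinity>" using sol by (simp add: state_solution_def)
    finally show "integrable (?\<mu> \<Otimes>\<^sub>M M) (\<lambda>x. (case x of (t, \<omega>) \<Rightarrow> y t \<omega>)\<^sup>2)"
      using meas by (intro integrableI_bounded) auto
  qed
qed

lemma integral_time_measure_subset:
  fixes f :: "real \<Rightarrow> real"
  assumes "t \<le> T"
  shows "(\<integral>s. f s \<partial>time_measure t) = (\<integral>s. indicator {0..t} s * f s \<partial>time_measure T)"
proof -
  have "(\<integral>s. f s \<partial>time_measure t) = (\<integral>s. indicator {0..t} s *\<^sub>R f s \<partial>lborel)"
    by (intro integral_restrict_space) auto
  also have "\<dots> = (\<integral>s. indicator {0..T} s *\<^sub>R (indicator {0..t} s * f s) \<partial>lborel)"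
    using assms by (intro Bochner_Integration.integral_cong) (auto simp: indicator_def)
  also have "\<dots> = (\<integral>s. indicator {0..t} s * f s \<partial>time_measure T)"
    by (intro integral_restrict_space[symmetric]) auto
  finally show ?thesis .
qed

text \<open>Subtracting the two state equations path by path before taking means cancels the inhomogeneity of
  the drift, about which only pathwise integrability is known, and leaves an integrand that is
  integrable for the product measure.\<close>

lemma mean_difference_volterra:
  assumes "prob_space M" and T: "0 < T" "T = horizon P"
    and bm: "brownian_motion M (natural_filtration M W) T W"
    and cy: "continuous_on {0..T} (b_y P)" and cu: "continuous_on {0..T} (b_u P)"
    and u: "u \<in> L2 T" "state_solution M (natural_filtration M W) W P u y"
    and v: "v \<in> L2 T" "state_solution M (natural_filtration M W) W P v z"
  defines "D \<equiv> \<lambda>t. \<integral>\<omega>. y t \<omega> - z t \<omega> \<partial>M"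
  shows "integrable (time_measure T) D"
    and "\<And>t. t \<in> {0..T} \<Longrightarrow> D t =
      (\<integral>s. indicator {0..t} s * (b_y P s * D s + b_u P s * (u s - v s)) \<partial>time_measure T)"
    and "(\<integral>t. (\<integral>\<omega>. y t \<omega> \<partial>M) \<partial>time_measure T) - (\<integral>t. (\<integral>\<omega>. z t \<omega> \<partial>M) \<partial>time_measure T) =
      (\<integral>t. D t \<partial>time_measure T)"
proof -
  let ?\<mu> = "time_measure T"
  interpret M: prob_space M by fact
  interpret \<mu>: finite_measure ?\<mu> by (rule finite_measure_time_measure)
  interpret pair: pair_sigma_finite ?\<mu> M ..
  have yz: "integrable (?\<mu> \<Otimes>\<^sub>M M) (\<lambda>(t, \<omega>). y t \<omega>)" "integrable (?\<mu> \<Otimes>\<^sub>M M) (\<lambda>(t, \<omega>). z t \<omega>)"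
    using state_solution_integrable[of M P W u y] state_solution_integrable[of M P W v z] assms by auto
  have diff: "integrable (?\<mu> \<Otimes>\<^sub>M M) (\<lambda>(t, \<omega>). y t \<omega> - z t \<omega>)"
    using Bochner_Integration.integrable_diff[OF yz] by (simp add: case_prod_unfold)
  show "integrable ?\<mu> D" unfolding D_def using pair.integrable_fst[OF diff] .
  show "(\<integral>t. (\<integral>\<omega>. y t \<omega> \<partial>M) \<partial>?\<mu>) - (\<integral>t. (\<integral>\<omega>. z t \<omega> \<partial>M) \<partial>?\<mu>) = (\<integral>t. D t \<partial>?\<mu>)"
    using Bochner_Integration.integral_diff[OF yz]
    unfolding D_def pair.integral_fst[OF yz(1)] pair.integral_fst[OF yz(2)] pair.integral_fst[OF diff]
    by (simp add: case_prod_unfold)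
  fix t assume t: "t \<in> {0..T}"
  define f where "f = (\<lambda>s. b_u P s * (u s - v s))"
  define g where "g = (\<lambda>s \<omega>. indicator {0..t} s * (b_y P s * (y s \<omega> - z s \<omega>) + f s))"
  have f: "integrable ?\<mu> f"
    unfolding f_def by (intro L2_mult_integrable L2_continuous cu L2_diff u v)
  have tset: "{0..t} \<in> sets ?\<mu>" using t by (subst sets_restrict_space_iff) auto
  have f_prod: "integrable (?\<mu> \<Otimes>\<^sub>M M) (\<lambda>(s, \<omega>). f s)"
    using f by (intro pair.Fubini_integrable) (auto simp: M.prob_space)
  have by_meas: "b_y P \<in> borel_measurable ?\<mu>" by (rule measurable_time_measure_continuous[OF cy])
  obtain K where K: "\<And>s. s \<in> {0..T} \<Longrightarrow> \<bar>b_y P s\<bar> \<le> K"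
    using continuous_on_Icc_bounded[OF cy] by blast
  have by_prod: "integrable (?\<mu> \<Otimes>\<^sub>M M) (\<lambda>(s, \<omega>). b_y P s * (y s \<omega> - z s \<omega>))"
  proof (rule Bochner_Integration.integrable_bound[where f = "\<lambda>x. K * (case x of (s, \<omega>) \<Rightarrow> y s \<omega> - z s \<omega>)"])
    show "(\<lambda>(s, \<omega>). b_y P s * (y s \<omega> - z s \<omega>)) \<in> borel_measurable (?\<mu> \<Otimes>\<^sub>M M)"
      using borel_measurable_times[OF measurable_compose[OF measurable_fst by_meas]
        borel_measurable_integrable[OF diff]] by (simp add: case_prod_unfold)
    show "AE x in ?\<mu> \<Otimes>\<^sub>M M. norm (case x of (s, \<omega>) \<Rightarrow> b_y P s * (y s \<omega> - z s \<omega>)) \<le>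
        norm (K * (case x of (s, \<omega>) \<Rightarrow> y s \<omega> - z s \<omega>))"
    proof (intro AE_I2)
      fix x assume "x \<in> space (?\<mu> \<Otimes>\<^sub>M M)"
      hence "\<bar>b_y P (fst x)\<bar> \<le> \<bar>K\<bar>"
        using K[of "fst x"] by (auto simp: space_pair_measure)
      thus "norm (case x of (s, \<omega>) \<Rightarrow> b_y P s * (y s \<omega> - z s \<omega>)) \<le>
          norm (K * (case x of (s, \<omega>) \<Rightarrow> y s \<omega> - z s \<omega>))"
        by (auto simp: abs_mult case_prod_unfold intro: mult_right_mono)
    qed
  qed (use diff in simp)
  have g_prod: "integrable (?\<mu> \<Otimes>\<^sub>M M) (\<lambda>(s, \<omega>). g s \<omega>)"
  proof -
    have "{0..t} \<times> space M \<in> sets (?\<mu> \<Otimes>\<^sub>M M)" using tset by simp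
    from integrable_mult_indicator[OF this Bochner_Integration.integrable_add[OF by_prod f_prod]]
    show ?thesis
      by (rule Bochner_Integration.integrable_cong[THEN iffD1, rotated 2])
        (auto simp: g_def space_pair_measure indicator_def)
  qed
  from u(2) t T obtain I where I: "has_ito_integral M (natural_filtration M W) W t (\<lambda>s \<omega>. diffusion P (y s \<omega>) (u s)) I"
    and yt: "AE \<omega> in M. y t \<omega> = y_init P + (\<integral>s. drift P s (y s \<omega>) (u s) \<partial>time_measure t) + I \<omega>"
    unfolding state_solution_def by blast
  from v(2) t T obtain I' where I': "has_ito_integral M (natural_filtration M W) W t (\<lambda>s \<omega>. diffusion P (z s \<omega>) (v s)) I'"
    and zt: "AE \<omega> in M. z t \<omega> = y_init P + (\<integral>s. drift P s (z s \<omega>) (v s) \<partial>time_measure t) + I' \<omega>"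
    unfolding state_solution_def by blast
  have tT: "t \<le> T" using t by simp
  note I = ito_integral_mean_zero[OF assms(1) bm tT I] and I' = ito_integral_mean_zero[OF assms(1) bm tT I']
  have "AE \<omega> in M. integrable ?\<mu> (\<lambda>s. drift P s (y s \<omega>) (u s))"
    "AE \<omega> in M. integrable ?\<mu> (\<lambda>s. drift P s (z s \<omega>) (v s))"
    using u(2) v(2) T(2) by (simp_all add: state_solution_def)
  with yt zt have path: "AE \<omega> in M. y t \<omega> - z t \<omega> = (\<integral>s. g s \<omega> \<partial>?\<mu>) + (I \<omega> - I' \<omega>)"
  proof eventually_elim
    case (elim \<omega>)
    have "(\<integral>s. drift P s (y s \<omega>) (u s) \<partial>time_measure t) - (\<integral>s. drift P s (z s \<omega>) (v s) \<partial>time_measure t) =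
      (\<integral>s. indicator {0..t} s * drift P s (y s \<omega>) (u s) - indicator {0..t} s * drift P s (z s \<omega>) (v s) \<partial>?\<mu>)"
      unfolding integral_time_measure_subset[OF tT]
      using integrable_mult_indicator[OF tset elim(3)] integrable_mult_indicator[OF tset elim(4)]
      by (intro Bochner_Integration.integral_diff[symmetric]) auto
    also have "\<dots> = (\<integral>s. g s \<omega> \<partial>?\<mu>)"
      by (intro Bochner_Integration.integral_cong) (auto simp: g_def f_def drift_def algebra_simps)
    finally show ?case using elim(1,2) by simp
  qed
  have g_int: "integrable M (\<lambda>\<omega>. \<integral>s. g s \<omega> \<partial>?\<mu>)" using pair.integrable_snd[OF g_prod] .
  have "(\<lambda>\<omega>. y t \<omega> - z t \<omega>) \<in> borel_measurable M"
    using measurable_compose_Pair1[OF _ borel_measurable_integrable[OF diff], of t] t by simp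
  hence "D t = (\<integral>\<omega>. (\<integral>s. g s \<omega> \<partial>?\<mu>) + (I \<omega> - I' \<omega>) \<partial>M)"
    unfolding D_def using path g_int I I' by (intro integral_cong_AE) auto
  also have "\<dots> = (\<integral>\<omega>. (\<integral>s. g s \<omega> \<partial>?\<mu>) \<partial>M)" using g_int I I' by simp
  also have "\<dots> = (\<integral>s. (\<integral>\<omega>. g s \<omega> \<partial>M) \<partial>?\<mu>)" using pair.Fubini_integral[OF g_prod] by simp
  also have "\<dots> = (\<integral>s. indicator {0..t} s * (b_y P s * D s + f s) \<partial>?\<mu>)"
  proof (rule integral_cong_AE)
    show "AE s in ?\<mu>. (\<integral>\<omega>. g s \<omega> \<partial>M) = indicator {0..t} s * (b_y P s * D s + f s)"
      using pair.AE_integrable_fst[OF diff]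
    proof eventually_elim
      case (elim s)
      have "(\<integral>\<omega>. b_y P s * (y s \<omega> - z s \<omega>) + f s \<partial>M) = b_y P s * D s + f s"
        using elim by (simp add: D_def M.prob_space)
      thus ?case unfolding g_def by simp
    qed
    show "(\<lambda>s. \<integral>\<omega>. g s \<omega> \<partial>M) \<in> borel_measurable ?\<mu>"
      using pair.integrable_fst[OF g_prod] by (rule borel_measurable_integrable)
    show "(\<lambda>s. indicator {0..t} s * (b_y P s * D s + f s)) \<in> borel_measurable ?\<mu>"
      using \<open>integrable ?\<mu> D\<close> by_meas f tset
      by (intro borel_measurable_times borel_measurable_add borel_measurable_indicator) auto
  qed
  finally show "D t = (\<integral>s. indicator {0..t} s * (b_y P s * D s + b_u P s * (u s - v s)) \<partial>?\<mu>)"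
    unfolding f_def .
qed

lemma lipschitz_on_bounded_derivative:
  fixes f f' :: "real \<Rightarrow> real"
  assumes "\<And>t. t \<in> {0..T} \<Longrightarrow> (f has_real_derivative f' t) (at t within {0..T})"
    and "\<And>t. t \<in> {0..T} \<Longrightarrow> \<bar>f' t\<bar> \<le> B" "0 \<le> B"
  shows "B-lipschitz_on {0..T} f"
proof (rule lipschitz_onI)
  fix x y assume "x \<in> {0..T}" "y \<in> {0..T}"
  thus "dist (f x) (f y) \<le> B * dist x y"
    unfolding dist_norm using assms by (intro field_differentiable_bound[of "{0..T}" f f']) auto
qed fact

text \<open>By the intermediate value theorem \<open>f\<close> has one sign on \<open>[0,T)\<close>; an integral zero would force
  \<open>f = 0\<close> almost everywhere.\<close>

lemma integral_ne_zero_of_nonvanishing: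
  assumes T: "0 < T" and cont: "continuous_on {0..T} f" and nz: "\<And>t. t \<in> {0..<T} \<Longrightarrow> f t \<noteq> (0::real)"
  shows "(\<integral>t. f t \<partial>time_measure T) \<noteq> 0"
proof
  assume zero: "(\<integral>t. f t \<partial>time_measure T) = 0"
  have int: "integrable (time_measure T) f" by (intro L2_integrable L2_continuous cont)
  have "connected (f ` {0..<T})"
    by (intro connected_continuous_image continuous_on_subset[OF cont]) auto
  hence interval: "is_interval (f ` {0..<T})" by (simp add: is_interval_connected_1)
  have same: "\<not> (f s < 0 \<and> 0 < f t)" if "s \<in> {0..<T}" "t \<in> {0..<T}" for s t
  proof
    assume "f s < 0 \<and> 0 < f t"
    hence "0 \<in> f ` {0..<T}"
      using mem_is_interval_1_I[OF interval, of "f s" "f t" 0] that by simp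
    thus False using nz by auto
  qed
  have ae: "AE t in time_measure T. t \<noteq> T"
    by (subst AE_restrict_space_iff) (auto intro: AE_mp[OF AE_lborel_singleton[of T]])
  have "AE t in time_measure T. f t = 0"
  proof (cases "\<exists>s\<in>{0..<T}. f s < 0")
    case True
    hence "AE t in time_measure T. 0 \<le> - f t"
      using same ae AE_space by (elim AE_mp) (intro AE_I2; force)
    moreover have "(\<integral>t. - f t \<partial>time_measure T) = 0" using zero by simp
    ultimately have "AE t in time_measure T. - f t = 0"
      using int by (subst (asm) integral_nonneg_eq_0_iff_AE) auto
    thus ?thesis by simp
  next
    case False
    have "AE t in time_measure T. 0 \<le> f t"
      using ae AE_space
    proof eventually_elim
      case (elim t)
      hence "t \<in> {0..<T}" by auto
      with False show ?case by (meson not_less)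
    qed
    thus ?thesis using zero int by (subst (asm) integral_nonneg_eq_0_iff_AE) auto
  qed
  with ae have "AE t in time_measure T. False"
  proof (rule AE_mp[OF _ AE_mp[OF _ AE_I2]])
    fix t assume "t \<in> space (time_measure T)"
    thus "f t = 0 \<longrightarrow> t \<noteq> T \<longrightarrow> False" using nz[of t] by (cases "t < T") auto
  qed
  hence "emeasure (time_measure T) (space (time_measure T)) = 0"
    unfolding ae_filter_eq_bot_iff[symmetric] trivial_limit_def .
  thus False using T by (simp add: emeasure_restrict_space)
qed

text \<open>The representer is \<open>\<phi> = b\<^sub>u \<psi>\<close> with \<open>\<psi>\<close> the adjoint solution. Its Lipschitz bound comes from the
  bounds on \<open>b\<^sub>y\<close>, \<open>b\<^sub>u\<close> and the time derivative of \<open>b\<^sub>u\<close>.\<close>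

lemma mean_state_affine:
  assumes "prob_space M" and T: "0 < T" "T = horizon P"
    and bm: "brownian_motion M (natural_filtration M W) T W"
    and sm: "state_map M (natural_filtration M W) W P Y" and data: "data_assumptions P"
  obtains \<phi> A where "A-lipschitz_on {0..T} \<phi>" "(\<integral>t. \<phi> t \<partial>time_measure T) \<noteq> 0"
    "\<And>u v. u \<in> L2 T \<Longrightarrow> v \<in> L2 T \<Longrightarrow>
      (\<integral>t. (\<integral>\<omega>. Y u t \<omega> \<partial>M) \<partial>time_measure T) - (\<integral>t. (\<integral>\<omega>. Y v t \<omega> \<partial>M) \<partial>time_measure T) =
      L2_inner T \<phi> (\<lambda>t. u t - v t)"
proof -
  from data T(2) obtain C c where c: "0 < c"
    and bound: "\<And>t. t \<in> {0..T} \<Longrightarrow> \<bar>b_y P t\<bar> + \<bar>b_u P t\<bar> \<le> C" "\<And>t. t \<in> {0..T} \<Longrightarrow> c \<le> \<bar>b_u P t\<bar>"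
    unfolding data_assumptions_def by blast
  from data T(2) obtain K dby dbu where
    dby: "\<And>t. t \<in> {0..T} \<Longrightarrow> (b_y P has_real_derivative dby t) (at t within {0..T})" and
    dbu: "\<And>t. t \<in> {0..T} \<Longrightarrow> (b_u P has_real_derivative dbu t) (at t within {0..T})" and
    K: "\<And>t. t \<in> {0..T} \<Longrightarrow> \<bar>dby t\<bar> + \<bar>dbu t\<bar> \<le> K"
    unfolding data_assumptions_def by metis
  have cy: "continuous_on {0..T} (b_y P)" by (rule DERIV_continuous_on) (rule dby)
  have cu: "continuous_on {0..T} (b_u P)" by (rule DERIV_continuous_on) (rule dbu)
  obtain \<psi> where \<psi>: "\<And>t. t \<in> {0..T} \<Longrightarrow> (\<psi> has_real_derivative - (b_y P t * \<psi> t + 1)) (at t within {0..T})"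
    "\<psi> T = 0" "\<And>t. t \<in> {0..<T} \<Longrightarrow> 0 < \<psi> t"
    using adjoint_solution[OF T(1) cy] by blast
  have \<psi>_cont: "continuous_on {0..T} \<psi>" by (rule DERIV_continuous_on) (rule \<psi>(1))
  obtain R where R: "\<And>t. t \<in> {0..T} \<Longrightarrow> \<bar>\<psi> t\<bar> \<le> R"
    using continuous_on_Icc_bounded[OF \<psi>_cont] by blast
  define \<phi> where "\<phi> = (\<lambda>t. b_u P t * \<psi> t)"
  have \<phi>_cont: "continuous_on {0..T} \<phi>" unfolding \<phi>_def by (intro continuous_intros cu \<psi>_cont)
  have zero: "0 \<in> {0..T}" using T by simp
  have pos: "0 \<le> C" "0 \<le> K" "0 \<le> R" using bound(1)[OF zero] K[OF zero] R[OF zero] by auto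
  show ?thesis
  proof (rule that)
    show "(K * R + C * (C * R + 1))-lipschitz_on {0..T} \<phi>"
    proof (rule lipschitz_on_bounded_derivative)
      fix t assume t: "t \<in> {0..T}"
      show "(\<phi> has_real_derivative dbu t * \<psi> t + - (b_y P t * \<psi> t + 1) * b_u P t) (at t within {0..T})"
        unfolding \<phi>_def by (rule DERIV_mult[OF dbu[OF t] \<psi>(1)[OF t]])
      have "\<bar>dbu t * \<psi> t\<bar> \<le> K * R" unfolding abs_mult using K[OF t] R[OF t] pos by (intro mult_mono) auto
      moreover have "\<bar>- (b_y P t * \<psi> t + 1) * b_u P t\<bar> \<le> C * (C * R + 1)"
      proof -
        have "\<bar>b_y P t * \<psi> t\<bar> \<le> C * R"
          unfolding abs_mult using bound(1)[OF t] R[OF t] pos by (intro mult_mono) auto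
        hence "\<bar>b_u P t\<bar> * \<bar>b_y P t * \<psi> t + 1\<bar> \<le> C * (C * R + 1)"
          using bound(1)[OF t] pos by (intro mult_mono) auto
        thus ?thesis unfolding abs_mult abs_minus_cancel by (simp only: mult.commute)
      qed
      ultimately show "\<bar>dbu t * \<psi> t + - (b_y P t * \<psi> t + 1) * b_u P t\<bar> \<le> K * R + C * (C * R + 1)"
        by linarith
    qed (use pos in simp)
    show "(\<integral>t. \<phi> t \<partial>time_measure T) \<noteq> 0"
    proof (rule integral_ne_zero_of_nonvanishing[OF T(1) \<phi>_cont])
      fix t assume t: "t \<in> {0..<T}"
      thus "\<phi> t \<noteq> 0" using bound(2)[of t] \<psi>(3)[OF t] c by (auto simp: \<phi>_def)
    qed
  next
    fix u v assume uv: "u \<in> L2 T" "v \<in> L2 T"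
    have sol: "state_solution M (natural_filtration M W) W P u (Y u)"
      "state_solution M (natural_filtration M W) W P v (Y v)"
      using sm uv T(2) by (simp_all add: state_map_def)
    note mean = mean_difference_volterra[OF assms(1) T bm cy cu uv(1) sol(1) uv(2) sol(2)]
    have "integrable (time_measure T) (\<lambda>t. b_u P t * (u t - v t))"
      by (intro L2_mult_integrable L2_continuous cu L2_diff uv)
    from volterra_duality[OF T(1) cy \<psi>(1,2) mean(1) this mean(2)]
    show "(\<integral>t. (\<integral>\<omega>. Y u t \<omega> \<partial>M) \<partial>time_measure T) - (\<integral>t. (\<integral>\<omega>. Y v t \<omega> \<partial>M) \<partial>time_measure T) =
      L2_inner T \<phi> (\<lambda>t. u t - v t)"
      unfolding mean(3) by (simp add: L2_inner_def \<phi>_def mult_ac)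
  qed
qed

section \<open>Error bound for the least squares Monte Carlo gradient projection\<close>

text \<open>This puts the Monte Carlo gradient into \<open>L\<^sup>2\<close>, as required of the inexact gradients in the
  iteration.\<close>

lemma lsmc_gradient_step_function:
  "\<exists>c. lsmc_gradient P N D \<omega> \<alpha>\<^sub>0 \<alpha>\<^sub>1 u = step_function (horizon P) N c"
  unfolding lsmc_gradient_def[abs_def] step_function_def[abs_def] Let_def by (rule exI) (rule refl)

theorem theorem4p2:
  fixes M :: "'a measure" and W :: "real \<Rightarrow> 'a \<Rightarrow> real"
    and P :: control_problem and T :: real
    and Y :: "(real \<Rightarrow> real) \<Rightarrow> real \<Rightarrow> 'a \<Rightarrow> real"
    and J :: "(real \<Rightarrow> real) \<Rightarrow> real" and dJ :: "(real \<Rightarrow> real) \<Rightarrow> real \<Rightarrow> real"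
    and \<delta> C\<^sub>1 C\<^sub>2 \<rho> :: real and ustar :: "real \<Rightarrow> real"
    and S :: "'s measure" and \<omega> :: 's and D :: "nat \<Rightarrow> 's lsmc"
    and \<alpha>\<^sub>0 \<alpha>\<^sub>1 :: "nat \<Rightarrow> (real \<Rightarrow> real) \<Rightarrow> nat \<Rightarrow> nat \<Rightarrow> real"
    and dJN :: "nat \<Rightarrow> (real \<Rightarrow> real) \<Rightarrow> real \<Rightarrow> real"
    and u :: "nat \<Rightarrow> nat \<Rightarrow> real \<Rightarrow> real"
  defines "T \<equiv> horizon P"
    and "J \<equiv> cost M P Y"
    and "dJN \<equiv> \<lambda>N v. lsmc_gradient P N (D N) \<omega> (\<alpha>\<^sub>0 N v) (\<alpha>\<^sub>1 N v) v"
  assumes "0 < T"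
    and "prob_space M" and "complete_measure M"
    and "brownian_motion M (natural_filtration M W) T W"
    and "state_map M (natural_filtration M W) W P Y"
    and "data_assumptions P"
    and "continuously_L2_differentiable T J dJ"
    and "ustar \<in> admissible M P Y \<delta>"
    and "\<forall>v\<in>admissible M P Y \<delta>. J ustar \<le> J v"
    and "L2_lipschitz T ustar" and "L2_lipschitz T (dJ ustar)"
    and "0 < C\<^sub>1" and "0 < C\<^sub>2"
    and "\<forall>v\<in>L2 T. \<forall>w\<in>L2 T.
           L2_norm T (\<lambda>t. dJ v t - dJ w t) \<le> C\<^sub>1 * L2_norm T (\<lambda>t. v t - w t)"
    and "\<forall>v\<in>L2 T. \<forall>w\<in>L2 T.
           C\<^sub>2 * (L2_norm T (\<lambda>t. v t - w t))\<^sup>2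
             \<le> L2_inner T (\<lambda>t. dJ v t - dJ w t) (\<lambda>t. v t - w t)"
    and "0 < \<rho>"
    and "0 < 1 - 2 * C\<^sub>2 * \<rho> + (1 + 2 * C\<^sub>1\<^sup>2) * \<rho>\<^sup>2"
    and "1 - 2 * C\<^sub>2 * \<rho> + (1 + 2 * C\<^sub>1\<^sup>2) * \<rho>\<^sup>2 < 1"
    and "prob_space S" and "\<omega> \<in> space S"
    and "\<forall>N>0. 0 < sample_size (D N) \<and> 0 < size_eta (D N) \<and> 0 < size_xi (D N)"
    and "\<forall>N>0. independent_copies S M W T N (D N)"
    and "\<forall>N>0. \<forall>v\<in>step_controls T N.
           regression_coeffs P N (D N) \<omega> v (\<alpha>\<^sub>0 N v) (\<alpha>\<^sub>1 N v)"
    and "\<forall>N>0. u N 0 \<in> step_controls T N"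
    and "\<forall>N>0. \<forall>i. is_L2_projection T (step_controls T N \<inter> admissible M P Y \<delta>)
           (\<lambda>t. u N i t - \<rho> * dJN N (u N i) t) (u N (Suc i))"
  shows "\<exists>C>0. \<forall>N>0.
    limsup (\<lambda>i. ereal (L2_norm T (\<lambda>t. ustar t - u N (Suc i) t)))
      \<le> ereal C * (ereal (T / real N)
           + (SUP i. ereal (L2_norm T (\<lambda>t. dJ (u N i) t - dJN N (u N i) t))))"
proof -
  define G where "G v = (\<integral>t. (\<integral>\<omega>. Y v t \<omega> \<partial>M) \<partial>time_measure T)" for v
  have adm: "admissible M P Y \<delta> = {v \<in> L2 T. G v \<le> \<delta>}"
    by (simp add: admissible_def G_def T_def)
  obtain \<phi> A where \<phi>: "A-lipschitz_on {0..T} \<phi>" "(\<integral>t. \<phi> t \<partial>time_measure T) \<noteq> 0"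
    and affine: "\<And>v w. v \<in> L2 T \<Longrightarrow> w \<in> L2 T \<Longrightarrow> G v - G w = L2_inner T \<phi> (\<lambda>t. v t - w t)"
  proof (rule mean_state_affine[OF \<open>prob_space M\<close> \<open>0 < T\<close> meta_eq_to_obj_eq[OF T_def]
      \<open>brownian_motion M (natural_filtration M W) T W\<close>
      \<open>state_map M (natural_filtration M W) W P Y\<close> \<open>data_assumptions P\<close>], goal_cases)
    case (1 \<phi> A)
    show ?thesis by (rule that[OF 1(2,3)]) (unfold G_def, rule 1(4))
  qed
  have us: "ustar \<in> L2 T" "G ustar \<le> \<delta>" and min: "\<And>v. v \<in> L2 T \<Longrightarrow> G v \<le> \<delta> \<Longrightarrow> J ustar \<le> J v"
    using \<open>ustar \<in> admissible M P Y \<delta>\<close> \<open>\<forall>v\<in>admissible M P Y \<delta>. J ustar \<le> J v\<close> by (auto simp: adm)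
  have grad: "has_L2_gradient T J dJ"
    using \<open>continuously_L2_differentiable T J dJ\<close> by (simp add: continuously_L2_differentiable_def)
  have C1: "L2_norm T (\<lambda>t. dJ v t - dJ w t) \<le> C\<^sub>1 * L2_norm T (\<lambda>t. v t - w t)"
    and C2: "C\<^sub>2 * (L2_norm T (\<lambda>t. v t - w t))\<^sup>2 \<le> L2_inner T (\<lambda>t. dJ v t - dJ w t) (\<lambda>t. v t - w t)"
    if "v \<in> L2 T" "w \<in> L2 T" for v w
    using assms(17,18) that by simp_all
  show ?thesis
  proof (rule projected_gradient_limsup[where T = T and G = G and \<phi> = \<phi> and A = A and J = J and dJ = dJ
        and us = ustar and \<delta> = \<delta> and C\<^sub>1 = C\<^sub>1 and C\<^sub>2 = C\<^sub>2 and \<rho> = \<rho>], fact \<open>0 < T\<close>, fact affine,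
      fact \<phi>(1), fact \<phi>(2), fact grad, fact us(1), fact us(2), fact min, fact assms(13), fact assms(14),
      fact C1, fact C2, fact assms(19), fact assms(20), fact assms(21), goal_cases)
    case (1 C)
    show ?thesis
    proof (intro exI[of _ C] conjI allI impI)
      fix N :: nat assume N: "0 < N"
      show "limsup (\<lambda>i. ereal (L2_norm T (\<lambda>t. ustar t - u N (Suc i) t)))
        \<le> ereal C * (ereal (T / real N)
             + (SUP i. ereal (L2_norm T (\<lambda>t. dJ (u N i) t - dJN N (u N i) t))))"
      proof (rule 1(2)[OF N])
        show "u N 0 \<in> L2 T" using assms(27) N by (simp add: step_controls_def)
        fix i
        show "dJN N (u N i) \<in> L2 T"
          using lsmc_gradient_step_function[of P N "D N" \<omega> "\<alpha>\<^sub>0 N (u N i)" "\<alpha>\<^sub>1 N (u N i)" "u N i"]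
            L2_step_function[OF \<open>0 < T\<close>] by (auto simp: dJN_def T_def)
        show "is_L2_projection T (step_controls T N \<inter> {v \<in> L2 T. G v \<le> \<delta>})
            (\<lambda>t. u N i t - \<rho> * dJN N (u N i) t) (u N (Suc i))"
          using assms(28) N unfolding adm by blast
      qed
    qed (fact 1(1))
  qed
qed

end
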